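(* Assume that $\phi$ is regularly varying at infinity with index $\frac{\alpha}{2}$ for some $\alpha\in[0,1)$ (equivalently, $\psi$ is regularly varying at infinity with index $\alpha$). If $A$ is an $N$-function satisfying $A(t)\ge[\psi^{-1}(ct^{1+\varepsilon})]^d$ for all $t\ge0$, for some constants $\varepsilon>0$ and $c>0$, then there is a constant $C$ such that $$\|u\|_{\mathscr{C}_\psi^{\frac{\varepsilon}{1+\varepsilon}}}\le C\,\|u\|_{B^{\psi}_A}\qquad\text{for all }u\in B^\psi_A .$$
   Context: $S$ is a driftless subordinator with Lévy measure $\Pi$ on $(0,\infty)$, $\int_0^\infty(1\wedge t)\,\Pi(dt)<\infty$, and Laplace exponent $\phi(s)=-\log\mathbf{E}e^{-sS_1}=\int_0^\infty(1-e^{-st})\,\Pi(dt)$. $\psi(r)=\phi(r^2)$ for $r>0$, assumed to satisfy $\lim_{r\to\infty}\psi(r)=\infty$, and $\psi^{-1}$ is its inverse function. A measurable $f:(0,\infty)\to(0,\infty)$ is regularly varying at infinity with index $\gamma$ if $\lim_{x\to\infty}f(bx)/f(x)=b^\gamma$ for all $b>0$. $N$-function: $A(t)=\int_0^t\alpha_0(s)\,ds$ with $\alpha_0:[0,\infty)\to[0,\infty)$ nondecreasing, right continuous, $\alpha_0(0)=0$, $\alpha_0(t)>0$ for $t>0$, $\alpha_0(t)\to\infty$. Luxemburg norm: $\|f\|_A=\inf\{\kappa>0:\int_{\mathbb{R}^d}A(|f(x)|/\kappa)\,dx\le1\}$. $\psi$-decomposition: fix a smooth, nonnegative, rotationally symmetric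 $\chi$ on $\mathbb{R}^d$ with $\chi(\xi)=1$ for $|\xi|\le3/4$ and $\chi(\xi)=0$ for $|\xi|\ge1$. For $j\ge0$ let $\chi_j(\xi)=\chi(\xi/\psi^{-1}(2^j))$, $\Pi^\psi_jf=\mathcal{F}^{-1}((\chi_{j+1}-\chi_j)\mathcal{F}f)$, and $\Pi^\psi_{-1}f=\mathcal{F}^{-1}(\chi_0\mathcal{F}f)$. For $s\in\mathbb{R}$: $B^{\psi,s}_A$ is the space of tempered distributions $f$ on $\mathbb{R}^d$ with $\|f\|_{B^{\psi,s}_A}=\sup_{j\ge-1}2^{js}\|\Pi^\psi_jf\|_A<\infty$, $B^\psi_A=B^{\psi,1}_A$, and $\mathscr{C}^s_\psi$ is the analogous space with $\|f\|_{\mathscr{C}^s_\psi}=\sup_{j\ge-1}2^{js}\|\Pi^\psi_jf\|_\infty$. *)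

theory Defs
  imports "HOL-Probability.Probability"
begin

section \<open>Subordinators and regular variation\<close>

definition subordinator :: "'w measure \<Rightarrow> (real \<Rightarrow> 'w \<Rightarrow> real) \<Rightarrow> bool" where
  "subordinator M S \<longleftrightarrow>
     prob_space M \<and>
     (\<forall>t\<ge>0. S t \<in> borel_measurable M) \<and>
     (AE \<omega> in M. S 0 \<omega> = 0) \<and>
     (AE \<omega> in M. mono_on {0..} (\<lambda>t. S t \<omega>) \<and> (\<forall>t\<ge>0. continuous (at_right t) (\<lambda>t. S t \<omega>))) \<and>
     (\<forall>t\<ge>0. \<forall>h\<ge>0. distr M borel (\<lambda>\<omega>. S (t + h) \<omega> - S t \<omega>) = distr M borel (S h)) \<and>
     (\<forall>t :: nat \<Rightarrow> real. mono t \<and> 0 \<le> t 0 \<longrightarrow>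
        prob_space.indep_vars M (\<lambda>_. borel) (\<lambda>i \<omega>. S (t (Suc i)) \<omega> - S (t i) \<omega>) UNIV)"

definition subordinator_levy_measure :: "real measure \<Rightarrow> bool" where
  "subordinator_levy_measure \<nu> \<longleftrightarrow>
     sets \<nu> = sets borel \<and> emeasure \<nu> {..0} = 0 \<and> (\<integral>\<^sup>+t. ennreal (min 1 t) \<partial>\<nu>) < \<infinity>"

text \<open>
  For a subordinator, having no drift and Levy measure \<open>\<nu>\<close> means that the Levy-Khintchine
  formula holds with zero drift term.
\<close>

definition driftless_subordinator ::
    "'w measure \<Rightarrow> (real \<Rightarrow> 'w \<Rightarrow> real) \<Rightarrow> real measure \<Rightarrow> bool" where
  "driftless_subordinator M S \<nu> \<longleftrightarrow>
     subordinator M S \<and> subordinator_levy_measure \<nu> \<and>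
     (\<forall>t\<ge>0. \<forall>s\<ge>0. (LINT \<omega>|M. exp (- s * S t \<omega>)) = exp (- t * (LINT y|\<nu>. 1 - exp (- s * y))))"

definition laplace_exponent :: "'w measure \<Rightarrow> (real \<Rightarrow> 'w \<Rightarrow> real) \<Rightarrow> real \<Rightarrow> real" where
  "laplace_exponent M S s = - ln (LINT \<omega>|M. exp (- s * S 1 \<omega>))"

definition regularly_varying :: "(real \<Rightarrow> real) \<Rightarrow> real \<Rightarrow> bool" where
  "regularly_varying f \<gamma> \<longleftrightarrow>
     f \<in> borel_measurable (restrict_space borel {0<..}) \<and> (\<forall>x>0. f x > 0) \<and>
     (\<forall>b>0. ((\<lambda>x. f (b * x) / f x) \<longlongrightarrow> b powr \<gamma>) at_top)"

text \<open>
  The function \<open>\<psi>(r) = \<phi>(r\<^sup>2)\<close> is extended to \<open>r = 0\<close> by \<open>\<psi>(0) = \<phi>(0) = 0\<close>, so that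
  its inverse is defined on \<open>[0, \<infinity>)\<close> with value \<open>0\<close> at \<open>0\<close>.
\<close>

definition half_line_inverse :: "(real \<Rightarrow> real) \<Rightarrow> real \<Rightarrow> real" where
  "half_line_inverse \<psi> = the_inv_into {0..} \<psi>"

section \<open>N-functions and Luxemburg norms\<close>

definition N_function :: "(real \<Rightarrow> real) \<Rightarrow> bool" where
  "N_function A \<longleftrightarrow>
     (\<exists>a0. mono_on {0..} a0 \<and> (\<forall>t\<ge>0. continuous (at_right t) a0) \<and>
           a0 0 = 0 \<and> (\<forall>t>0. a0 t > 0) \<and> filterlim a0 at_top at_top \<and>
           (\<forall>t\<ge>0. A t = integral {0..t} a0))"

definition luxemburg_norm :: "(real \<Rightarrow> real) \<Rightarrow> ('a::euclidean_space \<Rightarrow> complex) \<Rightarrow> ennreal" where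
  "luxemburg_norm A f =
     Inf {ennreal \<kappa> | \<kappa>. \<kappa> > 0 \<and> (\<integral>\<^sup>+x. ennreal (A (norm (f x) / \<kappa>)) \<partial>lborel) \<le> 1}"

definition sup_norm :: "('a::euclidean_space \<Rightarrow> complex) \<Rightarrow> ennreal" where
  "sup_norm f = esssup lborel (\<lambda>x. ennreal (norm (f x)))"

section \<open>Smooth functions, Schwartz functions and tempered distributions\<close>

definition partial_deriv ::
    "'a::euclidean_space \<Rightarrow> ('a \<Rightarrow> 'b::real_normed_vector) \<Rightarrow> 'a \<Rightarrow> 'b" where
  "partial_deriv b f x = frechet_derivative f (at x) b"

text \<open>
  A list over \<open>Basis\<close> plays the role of a multi-index: it records the coordinate directions of
  the successive derivatives. Differentiability of all iterated partial derivatives makes them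
  all continuous, hence \<open>smooth\<close> means infinitely often continuously differentiable.
\<close>

definition iter_partial ::
    "'a::euclidean_space list \<Rightarrow> ('a \<Rightarrow> 'b::real_normed_vector) \<Rightarrow> 'a \<Rightarrow> 'b" where
  "iter_partial bs f = foldr partial_deriv bs f"

definition smooth :: "('a::euclidean_space \<Rightarrow> 'b::real_normed_vector) \<Rightarrow> bool" where
  "smooth f \<longleftrightarrow> (\<forall>bs. set bs \<subseteq> Basis \<longrightarrow> (\<forall>x. iter_partial bs f differentiable (at x)))"

definition schwartz :: "('a::euclidean_space \<Rightarrow> complex) set" where
  "schwartz = {f. smooth f \<and>
     (\<forall>k::nat. \<forall>bs. set bs \<subseteq> Basis \<longrightarrow>
        bdd_above (range (\<lambda>x. (1 + norm x) ^ k * norm (iter_partial bs f x))))}"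

definition schwartz_seminorm :: "nat \<Rightarrow> ('a::euclidean_space \<Rightarrow> complex) \<Rightarrow> real" where
  "schwartz_seminorm k f =
     (\<Sum>bs | set bs \<subseteq> Basis \<and> length bs \<le> k. SUP x. (1 + norm x) ^ k * norm (iter_partial bs f x))"

text \<open>
  Distributions are HOL functionals on all functions, but only their values on \<open>schwartz\<close> matter.
  Continuity is expressed by domination by one of the (increasing) norms \<open>schwartz_seminorm k\<close>,
  which generate the Schwartz topology.
\<close>

type_synonym 'a distribution = "('a \<Rightarrow> complex) \<Rightarrow> complex"

definition tempered_distribution :: "'a::euclidean_space distribution \<Rightarrow> bool" where
  "tempered_distribution u \<longleftrightarrow>
     (\<forall>f\<in>schwartz. \<forall>g\<in>schwartz. u (\<lambda>x. f x + g x) = u f + u g) \<and>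
     (\<forall>c. \<forall>f\<in>schwartz. u (\<lambda>x. c * f x) = c * u f) \<and>
     (\<exists>k C. \<forall>f\<in>schwartz. norm (u f) \<le> C * schwartz_seminorm k f)"

text \<open>
  \<open>represents g u\<close>: the distribution \<open>u\<close> is given by integration against the function \<open>g\<close>;
  such a \<open>g\<close> is unique up to Lebesgue null sets.
\<close>

definition represents :: "('a::euclidean_space \<Rightarrow> complex) \<Rightarrow> 'a distribution \<Rightarrow> bool" where
  "represents g u \<longleftrightarrow>
     g \<in> borel_measurable lborel \<and>
     (\<forall>f\<in>schwartz. integrable lborel (\<lambda>x. g x * f x) \<and> u f = (LINT x|lborel. g x * f x))"

text \<open>
  A norm on functions extends to distributions, with value \<open>\<infinity>\<close> (the infimum of the
  empty set) on distributions that are not functions. For the norms used here the value does not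
  depend on the representing function.
\<close>

definition distribution_norm ::
    "(('a::euclidean_space \<Rightarrow> complex) \<Rightarrow> ennreal) \<Rightarrow> 'a distribution \<Rightarrow> ennreal" where
  "distribution_norm N u = (INF g\<in>{g. represents g u}. N g)"

section \<open>Fourier transform\<close>

definition fourier :: "('a::euclidean_space \<Rightarrow> complex) \<Rightarrow> 'a \<Rightarrow> complex" where
  "fourier f \<xi> = (LINT x|lborel. cis (- (x \<bullet> \<xi>)) * f x)"

definition inv_fourier :: "('a::euclidean_space \<Rightarrow> complex) \<Rightarrow> 'a \<Rightarrow> complex" where
  "inv_fourier f x = complex_of_real (1 / (2 * pi) ^ DIM('a)) * (LINT \<xi>|lborel. cis (x \<bullet> \<xi>) * f \<xi>)"

definition dist_fourier :: "'a::euclidean_space distribution \<Rightarrow> 'a distribution" where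
  "dist_fourier u = (\<lambda>f. u (fourier f))"

definition dist_inv_fourier :: "'a::euclidean_space distribution \<Rightarrow> 'a distribution" where
  "dist_inv_fourier u = (\<lambda>f. u (inv_fourier f))"

definition dist_mult :: "('a \<Rightarrow> real) \<Rightarrow> 'a distribution \<Rightarrow> 'a distribution" where
  "dist_mult m u = (\<lambda>f. u (\<lambda>x. complex_of_real (m x) * f x))"

section \<open>The \<open>\<psi>\<close>-decomposition and the associated function spaces\<close>

text \<open>
  The cutoff function, customarily called chi, is written \<open>\<eta>\<close> because the symbol for
  chi is the binder of finite Cartesian products.
\<close>

definition cutoff :: "('a::euclidean_space \<Rightarrow> real) \<Rightarrow> bool" where
  "cutoff \<eta> \<longleftrightarrow>
     smooth \<eta> \<and> (\<forall>\<xi>. 0 \<le> \<eta> \<xi>) \<and>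
     (\<forall>T \<xi>. orthogonal_transformation T \<longrightarrow> \<eta> (T \<xi>) = \<eta> \<xi>) \<and>
     (\<forall>\<xi>. norm \<xi> \<le> 3 / 4 \<longrightarrow> \<eta> \<xi> = 1) \<and> (\<forall>\<xi>. norm \<xi> \<ge> 1 \<longrightarrow> \<eta> \<xi> = 0)"

definition psi_cutoff ::
    "('a::euclidean_space \<Rightarrow> real) \<Rightarrow> (real \<Rightarrow> real) \<Rightarrow> nat \<Rightarrow> 'a \<Rightarrow> real" where
  "psi_cutoff \<eta> \<psi> j \<xi> = \<eta> (\<xi> /\<^sub>R half_line_inverse \<psi> (2 ^ j))"

definition psi_multiplier ::
    "('a::euclidean_space \<Rightarrow> real) \<Rightarrow> (real \<Rightarrow> real) \<Rightarrow> int \<Rightarrow> 'a \<Rightarrow> real" where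
  "psi_multiplier \<eta> \<psi> j \<xi> =
     (if j \<ge> 0 then psi_cutoff \<eta> \<psi> (Suc (nat j)) \<xi> - psi_cutoff \<eta> \<psi> (nat j) \<xi>
      else psi_cutoff \<eta> \<psi> 0 \<xi>)"

definition psi_block ::
    "('a::euclidean_space \<Rightarrow> real) \<Rightarrow> (real \<Rightarrow> real) \<Rightarrow> int \<Rightarrow> 'a distribution \<Rightarrow> 'a distribution" where
  "psi_block \<eta> \<psi> j u = dist_inv_fourier (dist_mult (psi_multiplier \<eta> \<psi> j) (dist_fourier u))"

definition psi_norm ::
    "(('a::euclidean_space \<Rightarrow> complex) \<Rightarrow> ennreal) \<Rightarrow> ('a \<Rightarrow> real) \<Rightarrow> (real \<Rightarrow> real) \<Rightarrow> real \<Rightarrow>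
     'a distribution \<Rightarrow> ennreal" where
  "psi_norm N \<eta> \<psi> s u =
     (SUP j\<in>{-1::int..}. ennreal (2 powr (of_int j * s)) * distribution_norm N (psi_block \<eta> \<psi> j u))"

definition besov_orlicz_norm ::
    "('a::euclidean_space \<Rightarrow> real) \<Rightarrow> (real \<Rightarrow> real) \<Rightarrow> (real \<Rightarrow> real) \<Rightarrow> real \<Rightarrow>
     'a distribution \<Rightarrow> ennreal" where
  "besov_orlicz_norm \<eta> \<psi> A s u = psi_norm (luxemburg_norm A) \<eta> \<psi> s u"

definition besov_orlicz_space ::
    "('a::euclidean_space \<Rightarrow> real) \<Rightarrow> (real \<Rightarrow> real) \<Rightarrow> (real \<Rightarrow> real) \<Rightarrow> real \<Rightarrow> 'a distribution set" where
  "besov_orlicz_space \<eta> \<psi> A s =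
     {u. tempered_distribution u \<and> besov_orlicz_norm \<eta> \<psi> A s u < \<infinity>}"

definition holder_zygmund_norm ::
    "('a::euclidean_space \<Rightarrow> real) \<Rightarrow> (real \<Rightarrow> real) \<Rightarrow> real \<Rightarrow> 'a distribution \<Rightarrow> ennreal" where
  "holder_zygmund_norm \<eta> \<psi> s u = psi_norm sup_norm \<eta> \<psi> s u"

end

theory Submission
  imports Defs
begin

text \<open>
  The theorem compares, one dyadic block at a time, the supremum of a block \<open>\<Pi>\<^sub>j u\<close> with its
  Luxemburg norm. What makes such a comparison possible is that the Fourier transform of the block
  lives in a ball of radius \<open>\<rho> = \<psi>\<^sup>-\<^sup>1(2\<^sup>j\<^sup>+\<^sup>1)\<close>, so the block is locally an average of itself at
  scale \<open>1 / \<rho>\<close>. If \<open>h\<close> is the Fourier transform of the cutoff and \<open>h\<^sub>R(z) = R\<^sup>d h(R z)\<close>, then the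
  inverse transform \<open>\<eta>(\<xi> / R)\<close> of \<open>h\<^sub>R\<close> equals one on the spectrum of the block as soon as \<open>R \<ge> 4 \<rho> / 3\<close>, and
  the block \<open>g\<close> satisfies \<open>(2 \<pi>)\<^sup>d g(x) = \<integral> g(y) h\<^sub>R(y - x) dy\<close> for almost every \<open>x\<close>.

  A bound for \<open>g\<close> follows from any splitting \<open>\<bar>g\<bar> \<le> B + G\<close> into a bounded and an integrable part:
  the identity gives \<open>\<bar>g\<bar> \<le> K (B + \<rho>\<^sup>d \<integral> G)\<close>, because \<open>h\<^sub>R\<close> has an \<open>L\<^sup>1\<close> norm
  independent of \<open>R\<close> and a supremum of order \<open>R\<^sup>d\<close> (\<open>band_limited_sup_bound\<close>). Orlicz integrability
  supplies the splitting. The quotient \<open>A(t) / t\<close> is nondecreasing, hence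
  \<open>t \<le> s + (s / A(s)) A(t)\<close> for every level \<open>s > 0\<close>. If the modular of \<open>g / \<kappa>\<close> is at most one, this
  gives \<open>B = \<kappa> s\<close> and \<open>\<integral> G \<le> \<kappa> s / A(s)\<close> (\<open>luxemburg_splitting\<close>). At a level with
  \<open>A(s) \<ge> \<rho>\<^sup>d\<close> both contributions are of size \<open>\<kappa> s\<close>. The growth assumption on \<open>A\<close> says exactly
  that \<open>s = (2\<^sup>j\<^sup>+\<^sup>1 / c)\<^sup>a\<close> with \<open>a = 1 / (1 + \<epsilon>)\<close> is such a level. So passing from the
  Luxemburg norm to the supremum costs a factor of order \<open>2\<^sup>j\<^sup>a\<close>, and
  \<open>1 - a = \<epsilon> / (1 + \<epsilon>)\<close> is the smoothness that remains.

  The averaging identity must be extracted from a distribution that is known only through its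
  values on Schwartz functions. The kernels \<open>y \<mapsto> h\<^sub>R(y - x)\<close> are Schwartz functions
  (\<open>fourier_schwartz\<close>, \<open>schwartz_affine\<close>), and by Fourier inversion (\<open>fourier_inversion\<close>) their
  inverse transform is \<open>\<xi> \<mapsto> e\<^sup>i\<^sup>x\<^sup>\<xi> \<eta>(\<xi> / R)\<close>. After multiplication by the symbol of the block this is
  the same function of \<open>\<xi>\<close> for all \<open>R \<ge> 4 \<rho> / 3\<close>, so the pairing of the block with the kernel
  does not change when \<open>R\<close> grows. Since \<open>h\<^sub>R\<close> is an approximate identity, the limit
  \<open>R \<rightarrow> \<infinity>\<close>, tested on boxes, identifies this constant value with
  \<open>(2 \<pi>)\<^sup>d g(x)\<close> (\<open>dilated_kernel_reproduces\<close>).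
\<close>

section \<open>Smooth and Schwartz functions\<close>

lemma partial_deriv_eq:
  assumes "(f has_derivative f') (at x)"
  shows "partial_deriv b f x = f' b"
  using frechet_derivative_at[OF assms] by (simp add: partial_deriv_def)

text \<open>
  Smoothness quantifies over all iterated partial derivatives. It is established coinductively,
  by exhibiting a class of differentiable functions that partial derivatives do not leave; this
  avoids a Leibniz formula for derivatives of higher order.
\<close>
lemma smoothI_invariant_class:
  assumes "f \<in> X"
    and diff: "\<And>g x. g \<in> X \<Longrightarrow> g differentiable at x"
    and closed: "\<And>g b. g \<in> X \<Longrightarrow> b \<in> Basis \<Longrightarrow> partial_deriv b g \<in> X"
  shows "smooth f"
proof -
  have "iter_partial bs f \<in> X" if "set bs \<subseteq> Basis" for bs
    using that by (induction bs) (auto simp: iter_partial_def assms(1) closed)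
  then show ?thesis
    unfolding smooth_def using diff by blast
qed

lemma smooth_differentiable: "smooth f \<Longrightarrow> f differentiable at x"
  unfolding smooth_def by (metis empty_set empty_subsetI foldr.simps(1) id_apply iter_partial_def)

lemma smooth_has_derivative: "smooth f \<Longrightarrow> (f has_derivative frechet_derivative f (at x)) (at x)"
  using smooth_differentiable frechet_derivative_works by blast

lemma smooth_partial_deriv:
  assumes "smooth f" and "b \<in> Basis"
  shows "smooth (partial_deriv b f)"
  unfolding smooth_def
proof (intro allI impI)
  fix bs :: "'a list" and x
  assume "set bs \<subseteq> Basis"
  then have "iter_partial (bs @ [b]) f differentiable (at x)"
    using assms by (auto simp: smooth_def)
  then show "iter_partial bs (partial_deriv b f) differentiable at x"
    by (simp add: iter_partial_def)
qed

lemma smooth_continuous_on: "smooth f \<Longrightarrow> continuous_on S f"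
  by (meson continuous_on_eq_continuous_at continuous_on_subset differentiable_imp_continuous_within
      open_UNIV smooth_differentiable subset_UNIV)

lemma smooth_linear_comb:
  fixes f g :: "'a::euclidean_space \<Rightarrow> complex"
  assumes "smooth f" "smooth g"
  shows "smooth (\<lambda>x. \<alpha> * f x + \<beta> * g x)"
proof (rule smoothI_invariant_class[where X = "{h. \<exists>f g. smooth f \<and> smooth g \<and> h = (\<lambda>x. \<alpha> * f x + \<beta> * g x)}"])
  have der: "((\<lambda>x. \<alpha> * f x + \<beta> * g x) has_derivative
      (\<lambda>k. \<alpha> * frechet_derivative f (at x) k + \<beta> * frechet_derivative g (at x) k)) (at x)"
    if "smooth f" "smooth g" for f g :: "'a \<Rightarrow> complex" and x
    by (rule derivative_eq_intros smooth_has_derivative[OF that(1)] smooth_has_derivative[OF that(2)] refl)+ auto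
  {
    fix h :: "'a \<Rightarrow> complex" and x
    assume "h \<in> {h. \<exists>f g. smooth f \<and> smooth g \<and> h = (\<lambda>x. \<alpha> * f x + \<beta> * g x)}"
    then show "h differentiable at x"
      using der unfolding differentiable_def by blast
  next
    fix h :: "'a \<Rightarrow> complex" and b :: 'a
    assume "h \<in> {h. \<exists>f g. smooth f \<and> smooth g \<and> h = (\<lambda>x. \<alpha> * f x + \<beta> * g x)}" and b: "b \<in> Basis"
    then obtain f g where fg: "smooth f" "smooth g" "h = (\<lambda>x. \<alpha> * f x + \<beta> * g x)" by blast
    have "partial_deriv b h = (\<lambda>x. \<alpha> * partial_deriv b f x + \<beta> * partial_deriv b g x)"
      using partial_deriv_eq[OF der[OF fg(1,2)]] fg(3) by (auto simp: partial_deriv_def)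
    then show "partial_deriv b h \<in> {h. \<exists>f g. smooth f \<and> smooth g \<and> h = (\<lambda>x. \<alpha> * f x + \<beta> * g x)}"
      using smooth_partial_deriv[OF fg(1) b] smooth_partial_deriv[OF fg(2) b] by blast
  }
qed (use assms in blast)

lemma smooth_of_real:
  fixes f :: "'a::euclidean_space \<Rightarrow> real"
  assumes "smooth f"
  shows "smooth (\<lambda>x. complex_of_real (f x))"
proof (rule smoothI_invariant_class[where X = "{h. \<exists>f. smooth f \<and> h = (\<lambda>x. complex_of_real (f x))}"])
  have der: "((\<lambda>x. complex_of_real (f x)) has_derivative
      (\<lambda>k. complex_of_real (frechet_derivative f (at x) k))) (at x)"
    if "smooth f" for f :: "'a \<Rightarrow> real" and x
    by (intro has_derivative_of_real smooth_has_derivative that)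
  {
    fix h :: "'a \<Rightarrow> complex" and x
    assume "h \<in> {h. \<exists>f. smooth f \<and> h = (\<lambda>x. complex_of_real (f x))}"
    then show "h differentiable at x"
      using der unfolding differentiable_def by blast
  next
    fix h :: "'a \<Rightarrow> complex" and b :: 'a
    assume "h \<in> {h. \<exists>f. smooth f \<and> h = (\<lambda>x. complex_of_real (f x))}" and b: "b \<in> Basis"
    then obtain f where f: "smooth f" "h = (\<lambda>x. complex_of_real (f x))" by blast
    have "partial_deriv b h = (\<lambda>x. complex_of_real (partial_deriv b f x))"
      using partial_deriv_eq[OF der[OF f(1)]] f(2) by (auto simp: partial_deriv_def)
    then show "partial_deriv b h \<in> {h. \<exists>f. smooth f \<and> h = (\<lambda>x. complex_of_real (f x))}"
      using smooth_partial_deriv[OF f(1) b] by blast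
  }
qed (use assms in blast)

text \<open>
  The class in this proof has to contain a second summand, since
  \<open>\<partial>\<^sub>b (x\<^sub>c f) = x\<^sub>c \<partial>\<^sub>b f + (b \<bullet> c) f\<close> is not of the form coordinate times smooth function.
\<close>
lemma smooth_mult_coordinate:
  fixes f :: "'a::euclidean_space \<Rightarrow> complex"
  assumes "smooth f"
  shows "smooth (\<lambda>x. complex_of_real (x \<bullet> c) * f x)"
proof (rule smoothI_invariant_class[where X = "{h. \<exists>f g. smooth f \<and> smooth g \<and>
    h = (\<lambda>x. complex_of_real (x \<bullet> c) * f x + g x)}"])
  have der: "((\<lambda>x. complex_of_real (x \<bullet> c) * f x + g x) has_derivative
      (\<lambda>k. complex_of_real (x \<bullet> c) * frechet_derivative f (at x) k + complex_of_real (k \<bullet> c) * f x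
        + frechet_derivative g (at x) k)) (at x)"
    if "smooth f" "smooth g" for f g :: "'a \<Rightarrow> complex" and x
    by (rule derivative_eq_intros smooth_has_derivative[OF that(1)] smooth_has_derivative[OF that(2)] refl)+ auto
  {
    fix h :: "'a \<Rightarrow> complex" and x
    assume "h \<in> {h. \<exists>f g. smooth f \<and> smooth g \<and> h = (\<lambda>x. complex_of_real (x \<bullet> c) * f x + g x)}"
    then show "h differentiable at x"
      using der unfolding differentiable_def by blast
  next
    fix h :: "'a \<Rightarrow> complex" and b :: 'a
    assume "h \<in> {h. \<exists>f g. smooth f \<and> smooth g \<and> h = (\<lambda>x. complex_of_real (x \<bullet> c) * f x + g x)}"
      and b: "b \<in> Basis"
    then obtain f g where fg: "smooth f" "smooth g" "h = (\<lambda>x. complex_of_real (x \<bullet> c) * f x + g x)"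
      by blast
    have "partial_deriv b h = (\<lambda>x. complex_of_real (x \<bullet> c) * partial_deriv b f x
        + (complex_of_real (b \<bullet> c) * f x + 1 * partial_deriv b g x))"
      using partial_deriv_eq[OF der[OF fg(1,2)]] fg(3)
      by (auto simp: partial_deriv_def algebra_simps)
    moreover have "smooth (\<lambda>x. complex_of_real (b \<bullet> c) * f x + 1 * partial_deriv b g x)"
      by (intro smooth_linear_comb fg smooth_partial_deriv b)
    ultimately show "partial_deriv b h \<in> {h. \<exists>f g. smooth f \<and> smooth g \<and>
        h = (\<lambda>x. complex_of_real (x \<bullet> c) * f x + g x)}"
      using smooth_partial_deriv[OF fg(1) b] by blast
  }
  have "smooth (\<lambda>x. 0 * f x + 0 * f x)" by (intro smooth_linear_comb assms)
  then have "smooth (\<lambda>x::'a. 0::complex)" by simp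
  then show "(\<lambda>x. complex_of_real (x \<bullet> c) * f x) \<in> {h. \<exists>f g. smooth f \<and> smooth g \<and>
      h = (\<lambda>x. complex_of_real (x \<bullet> c) * f x + g x)}"
    using assms by (intro CollectI exI[of _ f] exI[of _ "\<lambda>x. 0"]) auto
qed

lemma has_derivative_affine:
  fixes F :: "'a::euclidean_space \<Rightarrow> complex"
  assumes "(F has_derivative F') (at (R *\<^sub>R (y - x)))"
  shows "((\<lambda>y. \<beta> * F (R *\<^sub>R (y - x))) has_derivative (\<lambda>k. \<beta> * F' (R *\<^sub>R k))) (at y)"
proof -
  have "((\<lambda>y. R *\<^sub>R (y - x)) has_derivative (\<lambda>k. R *\<^sub>R k)) (at y)"
    by (auto intro!: derivative_eq_intros)
  from has_derivative_mult_right[OF has_derivative_compose[OF this assms]] show ?thesis .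
qed

lemma iter_partial_affine:
  fixes f :: "'a::euclidean_space \<Rightarrow> complex"
  assumes "smooth f" and "set bs \<subseteq> Basis"
  shows "iter_partial bs (\<lambda>y. \<beta> * f (R *\<^sub>R (y - x)))
    = (\<lambda>y. (\<beta> * complex_of_real R ^ length bs) * iter_partial bs f (R *\<^sub>R (y - x)))"
  using assms(2)
proof (induction bs)
  case Nil
  then show ?case by (simp add: iter_partial_def)
next
  case (Cons b bs)
  define F where "F = iter_partial bs f"
  have step: "iter_partial (b # bs) (\<lambda>y. \<beta> * f (R *\<^sub>R (y - x)))
      = partial_deriv b (\<lambda>y. (\<beta> * complex_of_real R ^ length bs) * F (R *\<^sub>R (y - x)))"
    using Cons by (simp add: iter_partial_def F_def)
  have F: "(F has_derivative frechet_derivative F (at z)) (at z)" for z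
    using assms(1) Cons.prems unfolding smooth_def F_def
    by (auto intro!: frechet_derivative_works[THEN iffD1])
  have "((\<lambda>y. (\<beta> * complex_of_real R ^ length bs) * F (R *\<^sub>R (y - x))) has_derivative
      (\<lambda>k. (\<beta> * complex_of_real R ^ length bs) * frechet_derivative F (at (R *\<^sub>R (y - x))) (R *\<^sub>R k))) (at y)" for y
    by (rule has_derivative_affine[OF F])
  from partial_deriv_eq[OF this, of b]
  have "iter_partial (b # bs) (\<lambda>y. \<beta> * f (R *\<^sub>R (y - x))) =
      (\<lambda>y. (\<beta> * complex_of_real R ^ length bs) * frechet_derivative F (at (R *\<^sub>R (y - x))) (R *\<^sub>R b))"
    unfolding step by auto
  moreover have "frechet_derivative F (at z) (R *\<^sub>R b) = R *\<^sub>R frechet_derivative F (at z) b" for z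
    using has_derivative_linear[OF F[of z]] by (simp add: linear_cmul)
  ultimately show ?case
    by (auto simp: F_def iter_partial_def partial_deriv_def scaleR_conv_of_real algebra_simps)
qed

text \<open>
  The weights at \<open>y\<close> and at \<open>z = R (y - x)\<close> are comparable:
  \<open>1 + \<bar>y\<bar> \<le> (1 + \<bar>x\<bar>) (1 + 1 / \<bar>R\<bar>) (1 + \<bar>z\<bar>)\<close>.
\<close>
lemma schwartz_affine:
  fixes f :: "'a::euclidean_space \<Rightarrow> complex"
  assumes f: "f \<in> schwartz" and "R \<noteq> 0"
  shows "(\<lambda>y. \<beta> * f (R *\<^sub>R (y - x))) \<in> schwartz"
proof -
  have sm: "smooth f" and bd: "\<And>k bs. set bs \<subseteq> Basis \<Longrightarrow>
      bdd_above (range (\<lambda>x. (1 + norm x) ^ k * norm (iter_partial bs f x)))"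
    using f by (auto simp: schwartz_def)
  have "smooth (\<lambda>y. \<beta> * f (R *\<^sub>R (y - x)))"
    unfolding smooth_def
  proof (intro allI impI)
    fix bs :: "'a list" and y
    assume bs: "set bs \<subseteq> Basis"
    then have "(iter_partial bs f has_derivative frechet_derivative (iter_partial bs f) (at z)) (at z)" for z
      using sm unfolding smooth_def by (auto intro!: frechet_derivative_works[THEN iffD1])
    then have "((\<lambda>y. (\<beta> * complex_of_real R ^ length bs) * iter_partial bs f (R *\<^sub>R (y - x))) has_derivative
      (\<lambda>k. (\<beta> * complex_of_real R ^ length bs) *
        frechet_derivative (iter_partial bs f) (at (R *\<^sub>R (y - x))) (R *\<^sub>R k))) (at y)"
      by (rule has_derivative_affine)
    then show "iter_partial bs (\<lambda>y. \<beta> * f (R *\<^sub>R (y - x))) differentiable at y"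
      unfolding iter_partial_affine[OF sm bs] differentiable_def by blast
  qed
  moreover have "bdd_above (range (\<lambda>y. (1 + norm y) ^ k * norm (iter_partial bs (\<lambda>y. \<beta> * f (R *\<^sub>R (y - x))) y)))"
    if bs: "set bs \<subseteq> Basis" for k and bs :: "'a list"
  proof -
    obtain B where B: "\<And>z. (1 + norm z) ^ k * norm (iter_partial bs f z) \<le> B"
      using bd[OF bs, of k] by (auto simp: bdd_above_def)
    define q where "q = (1 + norm x) * (1 + 1 / \<bar>R\<bar>)"
    have "(1 + norm y) ^ k * norm (iter_partial bs (\<lambda>y. \<beta> * f (R *\<^sub>R (y - x))) y)
        \<le> norm (\<beta> * complex_of_real R ^ length bs) * (q ^ k * B)" for y
    proof -
      define z where "z = R *\<^sub>R (y - x)"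
      have weight: "1 + (a + b * t) \<le> ((1 + a) * (1 + t)) * (1 + b)" if "0 \<le> a" "0 \<le> b" "0 \<le> t" for a b t :: real
      proof -
        have "((1 + a) * (1 + t)) * (1 + b) - (1 + (a + b * t)) = t + b + a * t + a * b + a * t * b"
          by (simp add: algebra_simps)
        with that show ?thesis by (smt (verit) mult_nonneg_nonneg)
      qed
      have "norm y \<le> norm x + norm (y - x)" by norm
      also have "norm (y - x) = norm z / \<bar>R\<bar>" using \<open>R \<noteq> 0\<close> by (simp add: z_def)
      finally have "1 + norm y \<le> q * (1 + norm z)"
        using weight[of "norm x" "norm z" "1 / \<bar>R\<bar>"] by (simp add: q_def)
      then have "(1 + norm y) ^ k \<le> q ^ k * (1 + norm z) ^ k"
        unfolding power_mult_distrib[symmetric] by (intro power_mono) auto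
      then have "(1 + norm y) ^ k * norm (iter_partial bs f z) \<le> q ^ k * (1 + norm z) ^ k * norm (iter_partial bs f z)"
        by (intro mult_right_mono) auto
      also have "\<dots> \<le> q ^ k * B"
        using B[of z] by (simp add: mult.assoc q_def mult_left_mono)
      finally have "norm (\<beta> * complex_of_real R ^ length bs) * ((1 + norm y) ^ k * norm (iter_partial bs f z))
          \<le> norm (\<beta> * complex_of_real R ^ length bs) * (q ^ k * B)"
        by (intro mult_left_mono) auto
      then show ?thesis
        unfolding iter_partial_affine[OF sm bs] z_def[symmetric] norm_mult
        by (simp only: mult_ac)
    qed
    then show ?thesis by (intro bdd_aboveI[of _ "norm (\<beta> * complex_of_real R ^ length bs) * (q ^ k * B)"]) auto
  qed
  ultimately show ?thesis by (auto simp: schwartz_def)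
qed

section \<open>Fourier transforms of smooth functions supported in the unit ball\<close>

text \<open>
  The closed unit ball as a common support makes the class stable under partial derivatives and
  under multiplication by coordinates, the two operations that the Fourier transform interchanges.
  The condition is imposed on the open set outside the ball, where it passes to derivatives.
\<close>
definition ball_test_functions :: "('a::euclidean_space \<Rightarrow> complex) set" where
  "ball_test_functions = {F. smooth F \<and> (\<forall>\<xi>. norm \<xi> > 1 \<longrightarrow> F \<xi> = 0)}"

lemma ball_test_functions_partial_deriv:
  assumes F: "F \<in> ball_test_functions" and b: "b \<in> Basis"
  shows "partial_deriv b F \<in> ball_test_functions"
proof -
  have "partial_deriv b F \<xi> = 0" if "norm \<xi> > 1" for \<xi>
  proof -
    have "open {\<xi>::'a. norm \<xi> > 1}" by (intro open_Collect_less continuous_intros)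
    then have "(F has_derivative (\<lambda>_. 0)) (at \<xi>)"
      using F that
      by (intro has_derivative_transform_within_open[of "\<lambda>_. 0" "\<lambda>_. 0" \<xi> UNIV "{\<xi>. norm \<xi> > 1}" F])
        (auto simp: ball_test_functions_def)
    then show ?thesis using partial_deriv_eq by fastforce
  qed
  then show ?thesis
    using F smooth_partial_deriv[OF _ b, of F] by (auto simp: ball_test_functions_def)
qed

lemma ball_test_functions_coordinate:
  assumes "F \<in> ball_test_functions"
  shows "(\<lambda>x. - \<i> * (complex_of_real (x \<bullet> c) * F x)) \<in> ball_test_functions"
proof -
  have "smooth (\<lambda>x. complex_of_real (x \<bullet> c) * F x)"
    using assms by (intro smooth_mult_coordinate) (auto simp: ball_test_functions_def)
  from smooth_linear_comb[OF this this, of "- \<i>" 0] assms show ?thesis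
    by (auto simp: ball_test_functions_def)
qed

lemma integrable_continuous_compact_support:
  fixes F :: "'a::euclidean_space \<Rightarrow> complex"
  assumes "continuous_on UNIV F" and "\<And>x. norm x > r \<Longrightarrow> F x = 0"
  shows "integrable lborel F"
proof -
  have "integrable lborel (\<lambda>x. indicator (cball 0 r) x *\<^sub>R F x)"
    using assms(1) by (intro borel_integrable_compact) (auto intro: continuous_on_subset)
  also have "(\<lambda>x. indicator (cball 0 r) x *\<^sub>R F x) = F"
    using assms(2) by (auto simp: indicator_def fun_eq_iff)
  finally show ?thesis .
qed

lemma bounded_continuous_compact_support:
  fixes F :: "'a::euclidean_space \<Rightarrow> complex"
  assumes "continuous_on UNIV F" and "\<And>x. norm x > r \<Longrightarrow> F x = 0"
  obtains B where "\<And>x. norm (F x) \<le> B"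
proof -
  have "bounded (F ` cball 0 r)"
    using assms(1) by (intro compact_imp_bounded compact_continuous_image) (auto intro: continuous_on_subset)
  then obtain B where "\<forall>x\<in>cball 0 r. norm (F x) \<le> B" by (auto simp: bounded_iff)
  then have "norm (F x) \<le> max B 0" for x
    using assms(2)[of x] by (cases "norm x \<le> r") (auto simp: le_max_iff_disj)
  with that show ?thesis by blast
qed

lemma ball_test_functions_integrable: "F \<in> ball_test_functions \<Longrightarrow> integrable lborel F"
  by (rule integrable_continuous_compact_support[of _ 1])
    (auto simp: ball_test_functions_def smooth_continuous_on)

lemma ball_test_functions_bounded:
  assumes "F \<in> ball_test_functions"
  obtains B where "\<And>x. norm (F x) \<le> B"
  by (rule bounded_continuous_compact_support[of F 1])
    (use assms that in \<open>auto simp: ball_test_functions_def smooth_continuous_on\<close>)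

lemma cis_measurable[measurable]: "cis \<in> borel_measurable borel"
  by (auto simp: cis_conv_exp intro!: borel_measurable_continuous_onI continuous_intros)

lemma integrable_cis_mult:
  assumes "integrable lborel (F :: 'a::euclidean_space \<Rightarrow> complex)"
  shows "integrable lborel (\<lambda>x. cis (v \<bullet> x) * F x)" "integrable lborel (\<lambda>x. cis (x \<bullet> v) * F x)"
    "integrable lborel (\<lambda>x. cis (- (x \<bullet> v)) * F x)" "integrable lborel (\<lambda>x. cis (- (v \<bullet> x)) * F x)"
proof -
  note [measurable] = borel_measurable_integrable[OF assms]
  show "integrable lborel (\<lambda>x. cis (v \<bullet> x) * F x)" "integrable lborel (\<lambda>x. cis (x \<bullet> v) * F x)"
    "integrable lborel (\<lambda>x. cis (- (x \<bullet> v)) * F x)" "integrable lborel (\<lambda>x. cis (- (v \<bullet> x)) * F x)"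
    by (rule Bochner_Integration.integrable_bound[OF assms]; simp add: norm_mult)+
qed

lemma norm_fourier_le:
  assumes "integrable lborel F"
  shows "norm (fourier F \<xi>) \<le> (LINT x|lborel. norm (F x))"
proof -
  have "norm (fourier F \<xi>) \<le> (LINT x|lborel. norm (cis (- (x \<bullet> \<xi>)) * F x))"
    unfolding fourier_def by (rule integral_norm_bound)
  then show ?thesis by (simp add: norm_mult)
qed

lemma cis_taylor: "norm (cis t - 1 - \<i> * complex_of_real t) \<le> t\<^sup>2"
proof -
  have "norm (iexp t - (\<Sum>k\<le>1. (\<i> * complex_of_real t) ^ k / fact k)) \<le> \<bar>t\<bar> ^ Suc 1 / fact (Suc 1)"
    by (rule iexp_approx1)
  also have "\<dots> \<le> t\<^sup>2" by (simp add: power2_eq_square)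
  finally show ?thesis by (simp add: cis_conv_exp algebra_simps)
qed

text \<open>
  Differentiation under the integral sign. On the unit ball \<open>(x \<bullet> k)\<^sup>2 \<le> \<bar>k\<bar>\<^sup>2\<close>, so the quadratic
  Taylor remainder of the exponential is bounded uniformly in \<open>x\<close>.
\<close>
lemma fourier_has_derivative:
  fixes F :: "'a::euclidean_space \<Rightarrow> complex"
  assumes F: "F \<in> ball_test_functions"
  shows "(fourier F has_derivative
    (\<lambda>k. \<Sum>b\<in>Basis. (k \<bullet> b) *\<^sub>R fourier (\<lambda>x. - \<i> * (complex_of_real (x \<bullet> b) * F x)) \<xi>)) (at \<xi>)"
    (is "(_ has_derivative ?D) _")
proof -
  define C where "C = (LINT x|lborel. norm (F x))"
  have intF: "integrable lborel F" using F by (rule ball_test_functions_integrable)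
  have intb: "integrable lborel (\<lambda>x. cis (- (x \<bullet> \<xi>)) * (- \<i> * (complex_of_real (x \<bullet> b) * F x)))" for b
    by (intro integrable_cis_mult ball_test_functions_integrable ball_test_functions_coordinate F)
  have D: "?D k = (LINT x|lborel. cis (- (x \<bullet> \<xi>)) * (- \<i> * (complex_of_real (x \<bullet> k) * F x)))" for k
  proof -
    have "?D k = (\<Sum>b\<in>Basis. (LINT x|lborel. (k \<bullet> b) *\<^sub>R (cis (- (x \<bullet> \<xi>)) * (- \<i> * (complex_of_real (x \<bullet> b) * F x)))))"
      unfolding fourier_def by simp
    also have "\<dots> = (LINT x|lborel. (\<Sum>b\<in>Basis. (k \<bullet> b) *\<^sub>R (cis (- (x \<bullet> \<xi>)) * (- \<i> * (complex_of_real (x \<bullet> b) * F x)))))"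
      by (rule Bochner_Integration.integral_sum[symmetric]) (intro integrable_scaleR_right intb)
    also have "\<dots> = (LINT x|lborel. cis (- (x \<bullet> \<xi>)) * (- \<i> * (complex_of_real (x \<bullet> k) * F x)))"
    proof (rule Bochner_Integration.integral_cong[OF refl])
      fix x :: 'a
      have "(\<Sum>b\<in>Basis. (k \<bullet> b) *\<^sub>R (cis (- (x \<bullet> \<xi>)) * (- \<i> * (complex_of_real (x \<bullet> b) * F x))))
        = cis (- (x \<bullet> \<xi>)) * (- \<i> * (complex_of_real (\<Sum>b\<in>Basis. (x \<bullet> b) * (k \<bullet> b)) * F x))"
        by (simp add: scaleR_conv_of_real sum_distrib_left sum_distrib_right sum_negf mult_ac)
      then show "(\<Sum>b\<in>Basis. (k \<bullet> b) *\<^sub>R (cis (- (x \<bullet> \<xi>)) * (- \<i> * (complex_of_real (x \<bullet> b) * F x))))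
        = cis (- (x \<bullet> \<xi>)) * (- \<i> * (complex_of_real (x \<bullet> k) * F x))"
        by (simp add: euclidean_inner[of x k])
    qed
    finally show ?thesis .
  qed
  have bound: "norm (fourier F (\<xi> + k) - fourier F \<xi> - ?D k) \<le> C * (norm k)\<^sup>2" for k
  proof -
    have i1: "integrable lborel (\<lambda>x. cis (- (x \<bullet> (\<xi> + k))) * F x)" "integrable lborel (\<lambda>x. cis (- (x \<bullet> \<xi>)) * F x)"
      by (intro integrable_cis_mult intF)+
    have i2: "integrable lborel (\<lambda>x. cis (- (x \<bullet> \<xi>)) * (- \<i> * (complex_of_real (x \<bullet> k) * F x)))"
      by (intro integrable_cis_mult ball_test_functions_integrable ball_test_functions_coordinate F)
    have split: "cis (- (x \<bullet> (\<xi> + k))) = cis (- (x \<bullet> \<xi>)) * cis (- (x \<bullet> k))" for x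
      by (simp add: cis_mult inner_add_right)
    have "fourier F (\<xi> + k) - fourier F \<xi> - ?D k = (LINT x|lborel. cis (- (x \<bullet> (\<xi> + k))) * F x
        - cis (- (x \<bullet> \<xi>)) * F x - cis (- (x \<bullet> \<xi>)) * (- \<i> * (complex_of_real (x \<bullet> k) * F x)))"
      unfolding D unfolding fourier_def by (simp only: Bochner_Integration.integral_diff Bochner_Integration.integrable_diff i1 i2)
    also have "\<dots> = (LINT x|lborel. (cis (- (x \<bullet> \<xi>)) * (cis (- (x \<bullet> k)) - 1 - \<i> * complex_of_real (- (x \<bullet> k)))) * F x)"
      by (intro Bochner_Integration.integral_cong refl)
        (simp only: split, simp add: algebra_simps)
    also have "norm \<dots> \<le> (LINT x|lborel. (norm k)\<^sup>2 * norm (F x))"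
    proof (rule Bochner_Integration.integral_norm_bound_integral)
      show "integrable lborel (\<lambda>x. (cis (- (x \<bullet> \<xi>)) * (cis (- (x \<bullet> k)) - 1 - \<i> * complex_of_real (- (x \<bullet> k)))) * F x)"
        using Bochner_Integration.integrable_diff[OF Bochner_Integration.integrable_diff[OF i1] i2]
        by (simp only: split, simp add: algebra_simps)
      show "integrable lborel (\<lambda>x. (norm k)\<^sup>2 * norm (F x))" using intF by simp
      fix x :: 'a
      show "norm ((cis (- (x \<bullet> \<xi>)) * (cis (- (x \<bullet> k)) - 1 - \<i> * complex_of_real (- (x \<bullet> k)))) * F x)
          \<le> (norm k)\<^sup>2 * norm (F x)"
      proof (cases "norm x \<le> 1")
        case True
        have "\<bar>x \<bullet> k\<bar> \<le> norm x * norm k" by (rule Cauchy_Schwarz_ineq2)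
        also have "\<dots> \<le> norm k" using True by (simp add: mult_left_le_one_le)
        finally have "(- (x \<bullet> k))\<^sup>2 \<le> (norm k)\<^sup>2" by (simp add: abs_le_square_iff[symmetric])
        with cis_taylor[of "- (x \<bullet> k)"]
        have "norm (cis (- (x \<bullet> k)) - 1 - \<i> * complex_of_real (- (x \<bullet> k))) \<le> (norm k)\<^sup>2" by linarith
        then show ?thesis by (simp only: norm_mult norm_cis mult_1 mult_right_mono norm_ge_zero)
      qed (use F in \<open>auto simp: ball_test_functions_def\<close>)
    qed
    finally show ?thesis by (simp add: C_def mult.commute)
  qed
  have "C \<ge> 0" by (simp add: C_def)
  have "bounded_linear ?D"
    by (intro bounded_linear_sum bounded_linear_scaleR_const bounded_linear_inner_left)
  moreover have "((\<lambda>k. norm (fourier F (\<xi> + k) - fourier F \<xi> - ?D k) / norm k) \<longlongrightarrow> 0) (at 0)"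
  proof (rule Lim_null_comparison)
    show "\<forall>\<^sub>F k in at 0. norm (norm (fourier F (\<xi> + k) - fourier F \<xi> - ?D k) / norm k) \<le> C * norm k"
      using bound by (intro eventuallyI)
        (auto simp: divide_simps power2_eq_square mult.assoc \<open>C \<ge> 0\<close> simp del: norm_eq_zero)
    have "((\<lambda>k::'a. C * norm k) \<longlongrightarrow> C * norm (0::'a)) (at 0)" by (intro tendsto_intros)
    then show "((\<lambda>k::'a. C * norm k) \<longlongrightarrow> 0) (at 0)" by simp
  qed
  ultimately show ?thesis by (simp add: has_derivative_at)
qed

lemma partial_deriv_fourier:
  fixes F :: "'a::euclidean_space \<Rightarrow> complex"
  assumes F: "F \<in> ball_test_functions" and b: "b \<in> Basis"
  shows "partial_deriv b (fourier F) = fourier (\<lambda>x. - \<i> * (complex_of_real (x \<bullet> b) * F x))"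
proof
  fix \<xi>
  show "partial_deriv b (fourier F) \<xi> = fourier (\<lambda>x. - \<i> * (complex_of_real (x \<bullet> b) * F x)) \<xi>"
    unfolding partial_deriv_eq[OF fourier_has_derivative[OF F]]
    using b by (simp add: inner_Basis if_distrib[of "\<lambda>t. t *\<^sub>R _"] sum.delta cong: if_cong)
qed

lemma iter_partial_fourier:
  assumes "F \<in> ball_test_functions" and "set bs \<subseteq> Basis"
  shows "\<exists>G\<in>ball_test_functions. iter_partial bs (fourier F) = fourier G"
  using assms(2)
proof (induction bs)
  case Nil
  with assms(1) show ?case by (auto simp: iter_partial_def)
next
  case (Cons b bs)
  then obtain G where "G \<in> ball_test_functions" "iter_partial bs (fourier F) = fourier G" by auto
  moreover from this have "iter_partial (b # bs) (fourier F) = fourier (\<lambda>x. - \<i> * (complex_of_real (x \<bullet> b) * G x))"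
    using Cons.prems by (simp only: partial_deriv_fourier[symmetric] set_simps insert_subset)
      (simp add: iter_partial_def)
  ultimately show ?case by (intro bexI[OF _ ball_test_functions_coordinate])
qed

lemma lborel_integral_affine:
  fixes f :: "'a::euclidean_space \<Rightarrow> 'b::{banach,second_countable_topology}"
  assumes "c \<noteq> 0" and [measurable]: "f \<in> borel_measurable borel"
  shows "(LINT x|lborel. f x) = \<bar>c\<bar> ^ DIM('a) *\<^sub>R (LINT x|lborel. f (t + c *\<^sub>R x))"
proof -
  have "(LINT x|lborel. f x)
      = (LINT x|density (distr lborel borel (\<lambda>x. t + c *\<^sub>R x)) (\<lambda>_. \<bar>c\<bar>^DIM('a)). f x)"
    using lborel_affine[OF assms(1), of t] by simp
  then show ?thesis by (simp add: integral_density integral_distr)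
qed

lemma lborel_integrable_affine:
  fixes f :: "'a::euclidean_space \<Rightarrow> 'b::{banach,second_countable_topology}"
  assumes "c \<noteq> 0" and "integrable lborel f"
  shows "integrable lborel (\<lambda>x. f (t + c *\<^sub>R x))"
proof -
  have [measurable]: "f \<in> borel_measurable borel" using borel_measurable_integrable[OF assms(2)] by simp
  have "integrable (density (distr lborel borel (\<lambda>x. t + c *\<^sub>R x)) (\<lambda>_. \<bar>c\<bar>^DIM('a))) f"
    using assms(2) lborel_affine[OF assms(1), of t] by simp
  then have "integrable lborel (\<lambda>x. \<bar>c\<bar> ^ DIM('a) *\<^sub>R f (t + c *\<^sub>R x))"
    by (simp add: integrable_density integrable_distr_eq)
  from integrable_scaleR_right[OF this, of "1 / \<bar>c\<bar> ^ DIM('a)"] show ?thesis using assms(1) by simp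
qed

lemma norm_diff_line_le:
  fixes F :: "'a::euclidean_space \<Rightarrow> complex"
  assumes "smooth F" and B: "\<And>x. norm (partial_deriv b F x) \<le> B"
  shows "norm (F (x + t *\<^sub>R b) - F x) \<le> B * \<bar>t\<bar>"
proof -
  have der: "((\<lambda>s. F (x + s *\<^sub>R b)) has_derivative (\<lambda>k. k *\<^sub>R partial_deriv b F (x + s *\<^sub>R b))) (at s)" for s
  proof -
    have "((\<lambda>s. F (x + s *\<^sub>R b)) has_derivative (\<lambda>k. frechet_derivative F (at (x + s *\<^sub>R b)) (k *\<^sub>R b))) (at s)"
      by (rule has_derivative_compose[OF _ smooth_has_derivative[OF assms(1)]])
        (auto intro!: derivative_eq_intros)
    then show ?thesis
      using has_derivative_linear[OF smooth_has_derivative[OF assms(1)]]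
      by (simp add: linear_cmul partial_deriv_def)
  qed
  have "norm ((\<lambda>s. F (x + s *\<^sub>R b)) t - (\<lambda>s. F (x + s *\<^sub>R b)) 0) \<le> B * norm (t - 0)"
  proof (rule differentiable_bound[of UNIV _ "\<lambda>s k. k *\<^sub>R partial_deriv b F (x + s *\<^sub>R b)"])
    fix s
    have "bounded_linear (\<lambda>k. k *\<^sub>R partial_deriv b F (x + s *\<^sub>R b))" by (rule bounded_linear_scaleR_left)
    show "onorm (\<lambda>k. k *\<^sub>R partial_deriv b F (x + s *\<^sub>R b)) \<le> B"
      by (rule onorm_bound) (use B order_trans[OF norm_ge_zero B] in \<open>auto simp: mult.commute[of B] mult_left_mono\<close>)
  qed (use der in \<open>auto intro: has_derivative_at_withinI\<close>)
  then show ?thesis by simp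
qed

lemma difference_quotient_tendsto:
  fixes f :: "real \<Rightarrow> 'b::real_normed_vector"
  assumes "(f has_vector_derivative D) (at 0)"
  shows "((\<lambda>s. (1 / s) *\<^sub>R (f s - f 0)) \<longlongrightarrow> D) (at 0)"
proof (rule LIM_zero_cancel, rule tendsto_norm_zero_cancel, rule Lim_transform_eventually)
  show "((\<lambda>s. norm (f (0 + s) - f 0 - s *\<^sub>R D) / norm s) \<longlongrightarrow> 0) (at 0)"
    using assms by (simp add: has_vector_derivative_def has_derivative_at)
  show "\<forall>\<^sub>F s in at 0. norm (f (0 + s) - f 0 - s *\<^sub>R D) / norm s = norm ((1 / s) *\<^sub>R (f s - f 0) - D)"
    unfolding eventually_at_filter
  proof (intro eventuallyI impI)
    fix s :: real assume "s \<noteq> 0"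
    then have "(1 / s) *\<^sub>R (f s - f 0) - D = (1 / s) *\<^sub>R (f (0 + s) - f 0 - s *\<^sub>R D)"
      by (simp add: algebra_simps)
    then show "norm (f (0 + s) - f 0 - s *\<^sub>R D) / norm s = norm ((1 / s) *\<^sub>R (f s - f 0) - D)"
      by (simp only: norm_scaleR) simp
  qed
qed

text \<open>
  Integration by parts, obtained from translation invariance of Lebesgue measure: the transform
  of a difference quotient of \<open>F\<close> in direction \<open>b\<close> is \<open>(e\<^sup>i\<^sup>t\<^sup>\<xi>\<^sup>b - 1) / t\<close> times the transform of
  \<open>F\<close>, and both sides converge as \<open>t \<rightarrow> 0\<close>.
\<close>
lemma fourier_partial_deriv:
  fixes F :: "'a::euclidean_space \<Rightarrow> complex"
  assumes F: "F \<in> ball_test_functions" and b: "b \<in> Basis"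
  shows "fourier (partial_deriv b F) \<xi> = \<i> * complex_of_real (\<xi> \<bullet> b) * fourier F \<xi>"
proof -
  have sm: "smooth F" using F by (simp add: ball_test_functions_def)
  obtain B where B: "\<And>x. norm (partial_deriv b F x) \<le> B"
    using ball_test_functions_bounded[OF ball_test_functions_partial_deriv[OF F b]] by blast
  have [measurable]: "F \<in> borel_measurable borel"
    using borel_measurable_integrable[OF ball_test_functions_integrable[OF F]] by simp
  have [measurable]: "partial_deriv b F \<in> borel_measurable borel"
    using borel_measurable_integrable[OF ball_test_functions_integrable[OF ball_test_functions_partial_deriv[OF F b]]] by simp
  define t where "t n = inverse (real (Suc n))" for n
  have t: "0 < t n" "t n \<le> 1" for n by (auto simp: t_def field_simps)
  have t0: "filterlim t (at 0) sequentially"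
    using LIMSEQ_inverse_real_of_nat t(1) by (auto simp: filterlim_at t_def[abs_def])
  define q where "q n x = (1 / t n) *\<^sub>R (F (x + t n *\<^sub>R b) - F x)" for n x
  have qm[measurable]: "q n \<in> borel_measurable borel" for n unfolding q_def by measurable
  have dq: "((\<lambda>s. F (x + s *\<^sub>R b)) has_vector_derivative partial_deriv b F x) (at 0)" for x
  proof -
    have "((\<lambda>s. F (x + s *\<^sub>R b)) has_derivative (\<lambda>k. frechet_derivative F (at (x + 0 *\<^sub>R b)) (k *\<^sub>R b))) (at 0)"
      by (rule has_derivative_compose[OF _ smooth_has_derivative[OF sm]])
        (auto intro!: derivative_eq_intros)
    then show ?thesis
      using has_derivative_linear[OF smooth_has_derivative[OF sm, of x]]
      by (simp add: has_vector_derivative_def linear_cmul partial_deriv_def)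
  qed
  have qlim: "(\<lambda>n. q n x) \<longlonglongrightarrow> partial_deriv b F x" for x
  proof -
    have "((\<lambda>s. (1 / s) *\<^sub>R (F (x + s *\<^sub>R b) - F x)) \<longlongrightarrow> partial_deriv b F x) (at 0)"
      using difference_quotient_tendsto[OF dq[of x]] by simp
    from filterlim_compose[OF this t0] show ?thesis by (simp add: q_def)
  qed
  have qfour: "(LINT x|lborel. cis (- (x \<bullet> \<xi>)) * q n x) = ((cis (t n * (b \<bullet> \<xi>)) - 1) / complex_of_real (t n)) * fourier F \<xi>" for n
  proof -
    have i: "integrable lborel (\<lambda>x. cis (- (x \<bullet> \<xi>)) * F (x + t n *\<^sub>R b))"
      using lborel_integrable_affine[of 1 F "t n *\<^sub>R b"] ball_test_functions_integrable[OF F]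
      by (intro integrable_cis_mult) (simp add: add.commute)
    have "(LINT x|lborel. cis (- (x \<bullet> \<xi>)) * F (x + t n *\<^sub>R b))
        = (LINT x|lborel. cis (- ((x - t n *\<^sub>R b) \<bullet> \<xi>)) * F x)"
      by (subst lborel_integral_affine[of 1 "\<lambda>x. cis (- ((x - t n *\<^sub>R b) \<bullet> \<xi>)) * F x" "t n *\<^sub>R b"])
         (auto simp: add.commute)
    also have "\<dots> = (LINT x|lborel. cis (t n * (b \<bullet> \<xi>)) * (cis (- (x \<bullet> \<xi>)) * F x))"
      by (intro Bochner_Integration.integral_cong) (auto simp: cis_mult inner_diff_left mult.assoc[symmetric])
    finally have 1: "(LINT x|lborel. cis (- (x \<bullet> \<xi>)) * F (x + t n *\<^sub>R b)) = cis (t n * (b \<bullet> \<xi>)) * fourier F \<xi>"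
      by (simp add: fourier_def)
    have "(LINT x|lborel. cis (- (x \<bullet> \<xi>)) * q n x)
      = (LINT x|lborel. (1 / t n) *\<^sub>R (cis (- (x \<bullet> \<xi>)) * F (x + t n *\<^sub>R b) - cis (- (x \<bullet> \<xi>)) * F x))"
      by (intro Bochner_Integration.integral_cong) (auto simp: q_def algebra_simps)
    also have "\<dots> = (1 / t n) *\<^sub>R (cis (t n * (b \<bullet> \<xi>)) * fourier F \<xi> - fourier F \<xi>)"
      using i integrable_cis_mult(3)[OF ball_test_functions_integrable[OF F]] 1
      by (simp add: fourier_def)
    finally show ?thesis by (simp add: scaleR_conv_of_real left_diff_distrib)
  qed
  have quotient_bound: "\<bar>1 / s\<bar> * r \<le> B" if "0 < s" "r \<le> B * \<bar>s\<bar>" for r s :: real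
    using that by (simp add: pos_divide_le_eq)
  have L1: "(\<lambda>n. LINT x|lborel. cis (- (x \<bullet> \<xi>)) * q n x) \<longlonglongrightarrow> (LINT x|lborel. cis (- (x \<bullet> \<xi>)) * partial_deriv b F x)"
  proof (rule integral_dominated_convergence[where w = "\<lambda>x. B * indicator (cball 0 2) x"])
    \<comment> \<open>Steps of length at most one keep the supports of the quotients in the ball of radius two.\<close>
    show "integrable lborel (\<lambda>x. B * indicator (cball (0::'a) 2) x)"
      using emeasure_lborel_cball_finite[of "0::'a" 2] by (intro integrable_mult_right integrable_real_indicator) auto
    show "AE x in lborel. norm (cis (- (x \<bullet> \<xi>)) * q n x) \<le> B * indicator (cball 0 2) x" for n
    proof (rule AE_I2)
      fix x :: 'a
      show "norm (cis (- (x \<bullet> \<xi>)) * q n x) \<le> B * indicator (cball 0 2) x"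
      proof (cases "norm x \<le> 2")
        case True
        then show ?thesis
          using quotient_bound[OF t(1)[of n] norm_diff_line_le[OF sm B, of x "t n"]]
          unfolding q_def norm_mult norm_cis norm_scaleR by simp
      next
        case False
        have "norm x \<le> norm (x + t n *\<^sub>R b) + norm (t n *\<^sub>R b)"
          using norm_triangle_ineq4[of "x + t n *\<^sub>R b" "t n *\<^sub>R b"] by simp
        moreover have "norm (t n *\<^sub>R b) \<le> 1" using t[of n] b by simp
        ultimately have "F (x + t n *\<^sub>R b) = 0" "F x = 0"
          using False F by (auto simp: ball_test_functions_def)
        with False show ?thesis by (simp add: q_def)
      qed
    qed
    show "AE x in lborel. (\<lambda>n. cis (- (x \<bullet> \<xi>)) * q n x) \<longlonglongrightarrow> cis (- (x \<bullet> \<xi>)) * partial_deriv b F x"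
      by (intro AE_I2 tendsto_intros qlim)
  qed measurable
  have "((\<lambda>s. (cis (s * (b \<bullet> \<xi>)) - 1) / complex_of_real s) \<longlongrightarrow> \<i> * complex_of_real (b \<bullet> \<xi>)) (at 0)"
  proof (rule LIM_zero_cancel, rule Lim_null_comparison)
    show "\<forall>\<^sub>F s in at 0. norm ((cis (s * (b \<bullet> \<xi>)) - 1) / complex_of_real s - \<i> * complex_of_real (b \<bullet> \<xi>))
        \<le> (b \<bullet> \<xi>)\<^sup>2 * \<bar>s\<bar>"
      unfolding eventually_at_filter
    proof (intro eventuallyI impI)
      fix s :: real assume "s \<noteq> 0"
      then have "(cis (s * (b \<bullet> \<xi>)) - 1) / complex_of_real s - \<i> * complex_of_real (b \<bullet> \<xi>)
          = (cis (s * (b \<bullet> \<xi>)) - 1 - \<i> * complex_of_real (s * (b \<bullet> \<xi>))) / complex_of_real s"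
        by (simp add: field_simps)
      moreover have "norm \<dots> \<le> (s * (b \<bullet> \<xi>))\<^sup>2 / \<bar>s\<bar>"
        unfolding norm_divide norm_of_real by (intro divide_right_mono cis_taylor) auto
      moreover have "(s * (b \<bullet> \<xi>))\<^sup>2 / \<bar>s\<bar> = (b \<bullet> \<xi>)\<^sup>2 * \<bar>s\<bar>"
        using \<open>s \<noteq> 0\<close> by (simp add: power_mult_distrib power2_eq_square abs_if)
      ultimately show "norm ((cis (s * (b \<bullet> \<xi>)) - 1) / complex_of_real s - \<i> * complex_of_real (b \<bullet> \<xi>))
          \<le> (b \<bullet> \<xi>)\<^sup>2 * \<bar>s\<bar>" by simp
    qed
    have "((\<lambda>s::real. (b \<bullet> \<xi>)\<^sup>2 * \<bar>s\<bar>) \<longlongrightarrow> (b \<bullet> \<xi>)\<^sup>2 * \<bar>0\<bar>) (at 0)" by (intro tendsto_intros)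
    then show "((\<lambda>s::real. (b \<bullet> \<xi>)\<^sup>2 * \<bar>s\<bar>) \<longlongrightarrow> 0) (at 0)" by simp
  qed
  from filterlim_compose[OF this t0]
  have "(\<lambda>n. ((cis (t n * (b \<bullet> \<xi>)) - 1) / complex_of_real (t n)) * fourier F \<xi>)
      \<longlonglongrightarrow> \<i> * complex_of_real (b \<bullet> \<xi>) * fourier F \<xi>"
    by (intro tendsto_intros)
  then have "(\<lambda>n. LINT x|lborel. cis (- (x \<bullet> \<xi>)) * q n x) \<longlonglongrightarrow> \<i> * complex_of_real (b \<bullet> \<xi>) * fourier F \<xi>"
    by (simp only: qfour)
  from LIMSEQ_unique[OF L1 this] show ?thesis
    by (simp add: fourier_def[of "partial_deriv b F"] inner_commute[of b])
qed

text \<open>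
  Each power of \<open>1 + \<bar>\<xi>\<bar>\<close> is paid for by one integration by parts, because
  \<open>\<bar>\<xi>\<bar> \<le> \<Sum>\<^sub>b \<bar>\<xi> \<bullet> b\<bar>\<close>.
\<close>
lemma fourier_decay:
  fixes F :: "'a::euclidean_space \<Rightarrow> complex"
  assumes "F \<in> ball_test_functions"
  shows "\<exists>C. \<forall>\<xi>. (1 + norm \<xi>) ^ k * norm (fourier F \<xi>) \<le> C"
  using assms
proof (induction k arbitrary: F)
  case 0
  then show ?case using norm_fourier_le[OF ball_test_functions_integrable] by auto
next
  case (Suc k)
  obtain C where C: "\<And>\<xi>. (1 + norm \<xi>) ^ k * norm (fourier F \<xi>) \<le> C" using Suc by blast
  have "\<exists>C. \<forall>\<xi>. (1 + norm \<xi>) ^ k * norm (fourier (partial_deriv b F) \<xi>) \<le> C" if "b \<in> Basis" for b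
    using Suc that ball_test_functions_partial_deriv by blast
  then obtain D where D: "\<And>b \<xi>. b \<in> Basis \<Longrightarrow> (1 + norm \<xi>) ^ k * norm (fourier (partial_deriv b F) \<xi>) \<le> D b"
    by metis
  have "(1 + norm \<xi>) ^ Suc k * norm (fourier F \<xi>) \<le> C + (\<Sum>b\<in>Basis. D b)" for \<xi>
  proof -
    have "(1 + norm \<xi>) ^ Suc k * norm (fourier F \<xi>)
        = (1 + norm \<xi>) ^ k * norm (fourier F \<xi>) + norm \<xi> * ((1 + norm \<xi>) ^ k * norm (fourier F \<xi>))"
      by (simp add: algebra_simps)
    also have "\<dots> \<le> C + (\<Sum>b\<in>Basis. \<bar>\<xi> \<bullet> b\<bar>) * ((1 + norm \<xi>) ^ k * norm (fourier F \<xi>))"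
      by (intro add_mono C mult_right_mono norm_le_l1) auto
    also have "(\<Sum>b\<in>Basis. \<bar>\<xi> \<bullet> b\<bar>) * ((1 + norm \<xi>) ^ k * norm (fourier F \<xi>))
        = (\<Sum>b\<in>Basis. (1 + norm \<xi>) ^ k * norm (fourier (partial_deriv b F) \<xi>))"
      unfolding sum_distrib_right
      by (intro sum.cong refl) (simp add: fourier_partial_deriv[OF Suc.prems] norm_mult)
    also have "\<dots> \<le> (\<Sum>b\<in>Basis. D b)" by (intro sum_mono D)
    finally show ?thesis by simp
  qed
  then show ?case by blast
qed

lemma fourier_schwartz:
  assumes "F \<in> ball_test_functions"
  shows "fourier F \<in> schwartz"
proof -
  have "iter_partial bs (fourier F) differentiable (at \<xi>)" if bs: "set bs \<subseteq> Basis" for bs \<xi>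
  proof -
    obtain G where G: "G \<in> ball_test_functions" "iter_partial bs (fourier F) = fourier G"
      using iter_partial_fourier[OF assms bs] by blast
    show ?thesis unfolding G(2) differentiable_def using fourier_has_derivative[OF G(1)] by blast
  qed
  moreover have "bdd_above (range (\<lambda>\<xi>. (1 + norm \<xi>) ^ k * norm (iter_partial bs (fourier F) \<xi>)))"
    if bs: "set bs \<subseteq> Basis" for k bs
  proof -
    obtain G where G: "G \<in> ball_test_functions" "iter_partial bs (fourier F) = fourier G"
      using iter_partial_fourier[OF assms bs] by blast
    show ?thesis unfolding G(2) using fourier_decay[OF G(1), of k] by (auto simp: bdd_above_def)
  qed
  ultimately show ?thesis by (auto simp: schwartz_def smooth_def)
qed

section \<open>The Gaussian and Fourier inversion\<close>

lemma lborel_Fubini_swap: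
  fixes f :: "'a::euclidean_space \<Rightarrow> 'b::euclidean_space \<Rightarrow> complex"
  assumes [measurable]: "case_prod f \<in> borel_measurable (lborel \<Otimes>\<^sub>M lborel)"
    and inner: "\<And>x. integrable lborel (f x)"
    and b: "integrable lborel b" "\<And>x. (LINT y|lborel. norm (f x y)) \<le> b x"
  shows "(LINT y|lborel. (LINT x|lborel. f x y)) = (LINT x|lborel. (LINT y|lborel. f x y))"
proof (rule lborel_pair.Fubini_integral, rule lborel_pair.Fubini_integrable)
  show "integrable lborel (\<lambda>x. LINT y|lborel. norm (case (x, y) of (x, y) \<Rightarrow> f x y))"
  proof (rule Bochner_Integration.integrable_bound[OF b(1)])
    show "AE x in lborel. norm (LINT y|lborel. norm (case (x, y) of (x, y) \<Rightarrow> f x y)) \<le> norm (b x)"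
      using b(2) by (auto intro!: AE_I2 order_trans[OF b(2) abs_ge_self] simp: integral_nonneg_AE)
  qed measurable
qed (use inner in auto)

lemma
  fixes f :: "'a::euclidean_space \<Rightarrow> real \<Rightarrow> complex"
  assumes int: "\<And>b. b \<in> Basis \<Longrightarrow> integrable lborel (f b)"
  shows lborel_integral_prod_Basis:
      "(LINT x|lborel. (\<Prod>b\<in>Basis. f b (x \<bullet> b))) = (\<Prod>b\<in>Basis. (LINT t|lborel. f b t))"
    and lborel_integrable_prod_Basis: "integrable lborel (\<lambda>x. \<Prod>b\<in>Basis. f b (x \<bullet> b))"
proof -
  interpret product_sigma_finite "\<lambda>_::'a. lborel :: real measure" ..
  have [measurable]: "\<And>b. b \<in> Basis \<Longrightarrow> f b \<in> borel_measurable borel"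
    using borel_measurable_integrable[OF int] by simp
  have meas: "(\<lambda>x. \<Prod>b\<in>Basis. f b (x \<bullet> b)) \<in> borel_measurable borel" by measurable
  have sumB: "(\<lambda>g. \<Sum>b\<in>Basis. g b *\<^sub>R b) \<in> (\<Pi>\<^sub>M b\<in>Basis. lborel) \<rightarrow>\<^sub>M (borel :: 'a measure)"
    by measurable
  have coord: "(\<Prod>b\<in>Basis. f b ((\<Sum>c\<in>Basis. g c *\<^sub>R c) \<bullet> b)) = (\<Prod>b\<in>Basis. f b (g b))" for g :: "'a \<Rightarrow> real"
    by (intro prod.cong refl) simp
  show "(LINT x|lborel. (\<Prod>b\<in>Basis. f b (x \<bullet> b))) = (\<Prod>b\<in>Basis. (LINT t|lborel. f b t))"
    by (subst lborel_eq, subst integral_distr[OF sumB meas], subst coord)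
      (rule product_integral_prod[OF finite_Basis int])
  show "integrable lborel (\<lambda>x. \<Prod>b\<in>Basis. f b (x \<bullet> b))"
    by (subst lborel_eq, subst integrable_distr_eq[OF sumB meas], subst coord)
      (rule product_integrable_prod[OF finite_Basis int])
qed

text \<open>
  A radial integrable weight; the exponent \<open>2 d\<close> makes it smaller than the product over the
  coordinates of \<open>1 / (1 + x\<^sub>b\<^sup>2)\<close>, whose integrability is a one-dimensional fact.
\<close>
definition decay_weight :: "'a::euclidean_space \<Rightarrow> real" where
  "decay_weight x = 1 / (1 + norm x) ^ (2 * DIM('a))"

lemma decay_weight_nonneg: "decay_weight x \<ge> 0"
  by (simp add: decay_weight_def)

lemma decay_weight_measurable[measurable]: "decay_weight \<in> borel_measurable borel"
  unfolding decay_weight_def by measurable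

lemma integrable_decay_weight: "integrable lborel (decay_weight :: 'a::euclidean_space \<Rightarrow> real)"
proof -
  have "integrable lborel (\<lambda>t::real. inverse (1 + t\<^sup>2))"
    using integrable_inverse_1_plus_square by (simp add: set_integrable_def)
  then have 1: "integrable lborel (\<lambda>t::real. complex_of_real (inverse (1 + t\<^sup>2)))" by (rule integrable_of_real)
  have "integrable lborel (\<lambda>x::'a. \<Prod>b\<in>Basis. complex_of_real (inverse (1 + (x \<bullet> b)\<^sup>2)))"
    by (rule lborel_integrable_prod_Basis) (rule 1)
  then show ?thesis
  proof (rule Bochner_Integration.integrable_bound)
    show "AE x::'a in lborel. norm (decay_weight x) \<le> norm (\<Prod>b\<in>Basis. complex_of_real (inverse (1 + (x \<bullet> b)\<^sup>2)))"
    proof (rule AE_I2)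
      fix x :: 'a
      have "1 + (x \<bullet> b)\<^sup>2 \<le> (1 + norm x)\<^sup>2" if "b \<in> Basis" for b
      proof -
        have "(x \<bullet> b)\<^sup>2 \<le> (norm x)\<^sup>2" using Basis_le_norm[OF that, of x] by (simp add: abs_le_square_iff[symmetric])
        then show ?thesis using norm_ge_zero[of x] by (simp add: power2_sum del: norm_ge_zero)
      qed
      then have "(\<Prod>b\<in>Basis. 1 + (x \<bullet> b)\<^sup>2) \<le> (\<Prod>b\<in>(Basis::'a set). (1 + norm x)\<^sup>2)"
        by (intro prod_mono) auto
      also have "\<dots> = (1 + norm x) ^ (2 * DIM('a))" by (simp add: power_mult)
      finally have "decay_weight x \<le> inverse (\<Prod>b\<in>Basis. 1 + (x \<bullet> b)\<^sup>2)"
        unfolding decay_weight_def inverse_eq_divide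
        by (intro divide_left_mono mult_pos_pos prod_pos) (auto intro!: zero_less_power add_pos_nonneg)
      also have "\<dots> = norm (\<Prod>b\<in>Basis. complex_of_real (inverse (1 + (x \<bullet> b)\<^sup>2)))"
        unfolding of_real_prod[symmetric] norm_of_real
        by (simp add: prod_inversef[symmetric] comp_def abs_prod)
      finally show "norm (decay_weight x) \<le> norm (\<Prod>b\<in>Basis. complex_of_real (inverse (1 + (x \<bullet> b)\<^sup>2)))"
        by (simp add: decay_weight_nonneg)
    qed
  qed measurable
qed

definition gaussian :: "'a::euclidean_space \<Rightarrow> real" where
  "gaussian x = exp (- (norm x)\<^sup>2 / 2)"

lemma gaussian_measurable[measurable]: "gaussian \<in> borel_measurable borel"
  unfolding gaussian_def by measurable

lemma gaussian_bounds: "0 \<le> gaussian x" "gaussian x \<le> 1"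
  by (auto simp: gaussian_def)

lemma gaussian_fourier_1d:
  shows "integrable lborel (\<lambda>t. cis (s * t) * complex_of_real (exp (- t\<^sup>2 / 2)))"
    and "(LINT t|lborel. cis (s * t) * complex_of_real (exp (- t\<^sup>2 / 2)))
      = complex_of_real (sqrt (2 * pi) * exp (- s\<^sup>2 / 2))"
proof -
  have dens: "exp (- t\<^sup>2 / 2) = sqrt (2 * pi) * std_normal_density t" for t :: real
    by (simp add: std_normal_density_def)
  have "integrable lborel (\<lambda>t. complex_of_real (sqrt (2 * pi) * std_normal_density t))"
    by (intro integrable_of_real integrable_mult_right) simp
  then show int: "integrable lborel (\<lambda>t. cis (s * t) * complex_of_real (exp (- t\<^sup>2 / 2)))"
    unfolding dens by (rule Bochner_Integration.integrable_bound) (auto simp: norm_mult)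
  have "char std_normal_distribution s = (LINT t|lborel. std_normal_density t *\<^sub>R iexp (s * t))"
    unfolding char_def by (intro integral_density) auto
  then have "complex_of_real (sqrt (2 * pi)) * complex_of_real (exp (- s\<^sup>2 / 2))
      = (LINT t|lborel. complex_of_real (sqrt (2 * pi)) * (std_normal_density t *\<^sub>R iexp (s * t)))"
    unfolding integral_mult_right_zero by (simp add: char_std_normal_distribution)
  also have "\<dots> = (LINT t|lborel. cis (s * t) * complex_of_real (exp (- t\<^sup>2 / 2)))"
    unfolding dens by (intro Bochner_Integration.integral_cong refl) (simp add: cis_conv_exp scaleR_conv_of_real)
  finally show "(LINT t|lborel. cis (s * t) * complex_of_real (exp (- t\<^sup>2 / 2)))
      = complex_of_real (sqrt (2 * pi) * exp (- s\<^sup>2 / 2))" by simp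
qed

lemma cis_sum: "finite I \<Longrightarrow> cis (\<Sum>i\<in>I. f i) = (\<Prod>i\<in>I. cis (f i))"
  by (induction I rule: finite_induct) (auto simp: cis_mult[symmetric])

lemma gaussian_prod: "gaussian x = (\<Prod>b\<in>Basis. exp (- (x \<bullet> b)\<^sup>2 / 2))"
proof -
  have "- (norm x)\<^sup>2 / 2 = (\<Sum>b\<in>Basis. - (x \<bullet> b)\<^sup>2 / 2)"
    unfolding power2_norm_eq_inner by (subst euclidean_inner)
      (simp add: power2_eq_square sum_divide_distrib sum_negf)
  then show ?thesis by (simp add: gaussian_def exp_sum)
qed

lemma gaussian_fourier:
  fixes v :: "'a::euclidean_space"
  shows "integrable lborel (\<lambda>\<xi>. cis (v \<bullet> \<xi>) * complex_of_real (gaussian \<xi>))"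
    and "(LINT \<xi>|lborel. cis (v \<bullet> \<xi>) * complex_of_real (gaussian \<xi>))
      = complex_of_real (sqrt (2 * pi) ^ DIM('a) * gaussian v)"
proof -
  have eq: "cis (v \<bullet> \<xi>) * complex_of_real (gaussian \<xi>)
      = (\<Prod>b\<in>Basis. cis ((v \<bullet> b) * (\<xi> \<bullet> b)) * complex_of_real (exp (- (\<xi> \<bullet> b)\<^sup>2 / 2)))" for \<xi> :: 'a
    unfolding gaussian_prod prod.distrib of_real_prod
    by (subst euclidean_inner) (simp add: cis_sum)
  show "integrable lborel (\<lambda>\<xi>. cis (v \<bullet> \<xi>) * complex_of_real (gaussian \<xi>))"
    unfolding eq by (rule lborel_integrable_prod_Basis) (rule gaussian_fourier_1d)
  show "(LINT \<xi>|lborel. cis (v \<bullet> \<xi>) * complex_of_real (gaussian \<xi>))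
      = complex_of_real (sqrt (2 * pi) ^ DIM('a) * gaussian v)"
    unfolding eq lborel_integral_prod_Basis[of "\<lambda>b t. cis ((v \<bullet> b) * t) * complex_of_real (exp (- t\<^sup>2 / 2))",
        OF gaussian_fourier_1d(1)] gaussian_fourier_1d(2)
    by (simp add: prod.distrib gaussian_prod)
qed

lemma gaussian_fourier_scaled:
  fixes v :: "'a::euclidean_space"
  assumes "\<delta> > 0"
  shows "integrable lborel (\<lambda>\<xi>. cis (v \<bullet> \<xi>) * complex_of_real (gaussian (\<delta> *\<^sub>R \<xi>)))"
    and "\<delta> ^ DIM('a) *\<^sub>R (LINT \<xi>|lborel. cis (v \<bullet> \<xi>) * complex_of_real (gaussian (\<delta> *\<^sub>R \<xi>)))
      = complex_of_real (sqrt (2 * pi) ^ DIM('a) * gaussian (v /\<^sub>R \<delta>))"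
proof -
  have eq: "cis ((v /\<^sub>R \<delta>) \<bullet> (\<delta> *\<^sub>R \<xi>)) = cis (v \<bullet> \<xi>)" for \<xi> :: 'a
    using assms by (simp add: mult.assoc[symmetric])
  show "integrable lborel (\<lambda>\<xi>. cis (v \<bullet> \<xi>) * complex_of_real (gaussian (\<delta> *\<^sub>R \<xi>)))"
    using lborel_integrable_affine[OF _ gaussian_fourier(1)[of "v /\<^sub>R \<delta>"], of \<delta> 0] assms
    by (simp only: add_0_left eq)
  have "(LINT \<xi>|lborel. cis ((v /\<^sub>R \<delta>) \<bullet> \<xi>) * complex_of_real (gaussian \<xi>))
    = \<bar>\<delta>\<bar> ^ DIM('a) *\<^sub>R (LINT \<xi>|lborel. cis ((v /\<^sub>R \<delta>) \<bullet> (0 + \<delta> *\<^sub>R \<xi>)) * complex_of_real (gaussian (0 + \<delta> *\<^sub>R \<xi>)))"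
    using assms by (intro lborel_integral_affine) auto
  then show "\<delta> ^ DIM('a) *\<^sub>R (LINT \<xi>|lborel. cis (v \<bullet> \<xi>) * complex_of_real (gaussian (\<delta> *\<^sub>R \<xi>)))
      = complex_of_real (sqrt (2 * pi) ^ DIM('a) * gaussian (v /\<^sub>R \<delta>))"
    using assms unfolding gaussian_fourier(2) by (simp only: add_0_left eq) simp
qed

text \<open>
  Without a damping factor the double integral behind Fourier inversion is not absolutely
  convergent. The Gaussian factor justifies Fubini, and its own transform turns the inner integral
  into an average of \<open>F\<close> over points at distance of order \<open>\<delta>\<close> from \<open>x\<close>.
\<close>
lemma gaussian_regularised_inversion:
  fixes F :: "'a::euclidean_space \<Rightarrow> complex"
  assumes int: "integrable lborel F" and \<delta>: "\<delta> > 0"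
  shows "(LINT \<xi>|lborel. cis (x \<bullet> \<xi>) * complex_of_real (gaussian (\<delta> *\<^sub>R \<xi>)) * fourier F \<xi>)
    = complex_of_real (sqrt (2 * pi) ^ DIM('a)) * (LINT z|lborel. complex_of_real (gaussian z) * F (x + \<delta> *\<^sub>R z))"
proof -
  define S where "S = complex_of_real (sqrt (2 * pi) ^ DIM('a))"
  have [measurable]: "F \<in> borel_measurable borel" using borel_measurable_integrable[OF int] by simp
  have gint: "integrable lborel (\<lambda>\<xi>::'a. gaussian (\<delta> *\<^sub>R \<xi>))"
    using integrable_norm[OF gaussian_fourier_scaled(1)[OF \<delta>, of 0]] by (simp add: gaussian_bounds)
  have "(LINT \<xi>|lborel. cis (x \<bullet> \<xi>) * complex_of_real (gaussian (\<delta> *\<^sub>R \<xi>)) * fourier F \<xi>)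
      = (LINT \<xi>|lborel. LINT y|lborel. cis (x \<bullet> \<xi>) * complex_of_real (gaussian (\<delta> *\<^sub>R \<xi>)) * (cis (- (y \<bullet> \<xi>)) * F y))"
    unfolding fourier_def by simp
  also have "\<dots> = (LINT y|lborel. LINT \<xi>|lborel. cis (x \<bullet> \<xi>) * complex_of_real (gaussian (\<delta> *\<^sub>R \<xi>)) * (cis (- (y \<bullet> \<xi>)) * F y))"
  proof (rule lborel_Fubini_swap[symmetric])
    show "integrable lborel (\<lambda>\<xi>::'a. gaussian (\<delta> *\<^sub>R \<xi>) * (LINT y|lborel. norm (F y)))"
      using gint by simp
    show "integrable lborel (\<lambda>y. cis (x \<bullet> \<xi>) * complex_of_real (gaussian (\<delta> *\<^sub>R \<xi>)) * (cis (- (y \<bullet> \<xi>)) * F y))" for \<xi>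
      by (intro integrable_mult_right integrable_cis_mult int)
    show "(LINT y|lborel. norm (cis (x \<bullet> \<xi>) * complex_of_real (gaussian (\<delta> *\<^sub>R \<xi>)) * (cis (- (y \<bullet> \<xi>)) * F y)))
        \<le> gaussian (\<delta> *\<^sub>R \<xi>) * (LINT y|lborel. norm (F y))" for \<xi>
      by (simp add: norm_mult gaussian_bounds)
  qed measurable
  also have "\<dots> = (LINT y|lborel. F y * (LINT \<xi>|lborel. cis ((x - y) \<bullet> \<xi>) * complex_of_real (gaussian (\<delta> *\<^sub>R \<xi>))))"
    unfolding integral_mult_right_zero[symmetric]
    by (intro Bochner_Integration.integral_cong refl)
      (simp add: inner_diff_left cis_divide[symmetric] cis_mult[symmetric] cis_inverse[symmetric] field_simps)
  also have "\<dots> = \<bar>\<delta>\<bar> ^ DIM('a) *\<^sub>R (LINT z|lborel. F (x + \<delta> *\<^sub>R z) *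
      (LINT \<xi>|lborel. cis ((x - (x + \<delta> *\<^sub>R z)) \<bullet> \<xi>) * complex_of_real (gaussian (\<delta> *\<^sub>R \<xi>))))"
    using \<delta> by (intro lborel_integral_affine[of \<delta> _ x]) auto
  also have "\<dots> = (LINT z|lborel. F (x + \<delta> *\<^sub>R z) *
      (\<delta> ^ DIM('a) *\<^sub>R (LINT \<xi>|lborel. cis ((- (\<delta> *\<^sub>R z)) \<bullet> \<xi>) * complex_of_real (gaussian (\<delta> *\<^sub>R \<xi>)))))"
    unfolding integral_scaleR_right[symmetric] using \<delta> by (intro Bochner_Integration.integral_cong refl) simp
  also have "\<dots> = (LINT z|lborel. S * (complex_of_real (gaussian z) * F (x + \<delta> *\<^sub>R z)))"
    unfolding gaussian_fourier_scaled(2)[OF \<delta>] using \<delta>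
    by (intro Bochner_Integration.integral_cong refl) (simp add: S_def gaussian_def mult_ac)
  finally show ?thesis by (simp add: S_def)
qed

text \<open>
  The limit \<open>\<delta> \<rightarrow> 0\<close> in \<open>gaussian_regularised_inversion\<close>: on the left the integrable function
  \<open>fourier F\<close> dominates, on the right the bound on \<open>F\<close> times the Gaussian.
\<close>
theorem fourier_inversion:
  fixes F :: "'a::euclidean_space \<Rightarrow> complex"
  assumes cont: "continuous_on UNIV F" and bdd: "\<And>x. norm (F x) \<le> B"
    and int: "integrable lborel F" and intf: "integrable lborel (fourier F)"
  shows "inv_fourier (fourier F) x = F x"
proof -
  define S where "S = complex_of_real (sqrt (2 * pi) ^ DIM('a))"
  define \<delta> where "\<delta> n = inverse (real (Suc n))" for n
  have \<delta>: "\<delta> n > 0" "\<delta> \<longlonglongrightarrow> 0" for n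
    using LIMSEQ_inverse_real_of_nat by (auto simp: \<delta>_def[abs_def])
  have [measurable]: "F \<in> borel_measurable borel" using borel_measurable_integrable[OF int] by simp
  have [measurable]: "fourier F \<in> borel_measurable borel" using borel_measurable_integrable[OF intf] by simp
  have gauss_lim: "(\<lambda>n. gaussian (\<delta> n *\<^sub>R \<xi>)) \<longlonglongrightarrow> 1" for \<xi> :: 'a
  proof -
    have "(\<lambda>n. exp (- (norm (\<delta> n *\<^sub>R \<xi>))\<^sup>2 / 2)) \<longlonglongrightarrow> exp (- (norm (0 *\<^sub>R \<xi>))\<^sup>2 / 2)"
      by (intro tendsto_intros \<delta>) auto
    then show ?thesis by (simp add: gaussian_def)
  qed
  have L: "(\<lambda>n. LINT \<xi>|lborel. cis (x \<bullet> \<xi>) * complex_of_real (gaussian (\<delta> n *\<^sub>R \<xi>)) * fourier F \<xi>)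
      \<longlonglongrightarrow> (LINT \<xi>|lborel. cis (x \<bullet> \<xi>) * fourier F \<xi>)"
  proof (rule integral_dominated_convergence[where w = "\<lambda>\<xi>. norm (fourier F \<xi>)"])
    show "AE \<xi> in lborel. (\<lambda>n. cis (x \<bullet> \<xi>) * complex_of_real (gaussian (\<delta> n *\<^sub>R \<xi>)) * fourier F \<xi>)
        \<longlonglongrightarrow> cis (x \<bullet> \<xi>) * fourier F \<xi>"
    proof (rule AE_I2)
      fix \<xi> :: 'a
      have "(\<lambda>n. cis (x \<bullet> \<xi>) * complex_of_real (gaussian (\<delta> n *\<^sub>R \<xi>)) * fourier F \<xi>)
        \<longlonglongrightarrow> cis (x \<bullet> \<xi>) * complex_of_real 1 * fourier F \<xi>"
        by (intro tendsto_intros gauss_lim)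
      then show "(\<lambda>n. cis (x \<bullet> \<xi>) * complex_of_real (gaussian (\<delta> n *\<^sub>R \<xi>)) * fourier F \<xi>)
        \<longlonglongrightarrow> cis (x \<bullet> \<xi>) * fourier F \<xi>" by simp
    qed
    show "AE \<xi> in lborel. norm (cis (x \<bullet> \<xi>) * complex_of_real (gaussian (\<delta> n *\<^sub>R \<xi>)) * fourier F \<xi>)
        \<le> norm (fourier F \<xi>)" for n
      by (auto simp: norm_mult gaussian_bounds mult_left_le_one_le)
  qed (use intf in \<open>auto intro: integrable_norm\<close>)
  have R0: "(\<lambda>n. LINT z|lborel. complex_of_real (gaussian z) * F (x + \<delta> n *\<^sub>R z))
      \<longlonglongrightarrow> (LINT z|lborel. complex_of_real (gaussian (z::'a)) * F x)"
  proof (rule integral_dominated_convergence[where w = "\<lambda>z::'a. gaussian z * B"])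
    have "integrable lborel (gaussian :: 'a \<Rightarrow> real)"
      using integrable_norm[OF gaussian_fourier(1)[of 0]] by (simp add: gaussian_bounds)
    then show "integrable lborel (\<lambda>z::'a. gaussian z * B)" by simp
    show "AE z in lborel. (\<lambda>n. complex_of_real (gaussian z) * F (x + \<delta> n *\<^sub>R z))
        \<longlonglongrightarrow> complex_of_real (gaussian z) * F x"
    proof (rule AE_I2)
      fix z :: 'a
      have "(\<lambda>n. x + \<delta> n *\<^sub>R z) \<longlonglongrightarrow> x + 0 *\<^sub>R z" by (intro tendsto_intros \<delta>)
      moreover have "isCont F (x + 0 *\<^sub>R z)"
        using cont by (simp add: continuous_on_eq_continuous_at)
      ultimately have "(\<lambda>n. F (x + \<delta> n *\<^sub>R z)) \<longlonglongrightarrow> F (x + 0 *\<^sub>R z)"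
        by (rule isCont_tendsto_compose[rotated])
      then show "(\<lambda>n. complex_of_real (gaussian z) * F (x + \<delta> n *\<^sub>R z))
        \<longlonglongrightarrow> complex_of_real (gaussian z) * F x" by (intro tendsto_intros) simp
    qed
    show "AE z in lborel. norm (complex_of_real (gaussian z) * F (x + \<delta> n *\<^sub>R z)) \<le> gaussian z * B" for n
      using bdd by (auto simp: norm_mult gaussian_bounds intro!: mult_left_mono)
  qed measurable
  have R: "(\<lambda>n. S * (LINT z|lborel. complex_of_real (gaussian z) * F (x + \<delta> n *\<^sub>R z)))
      \<longlonglongrightarrow> S * (LINT z|lborel. complex_of_real (gaussian (z::'a)) * F x)"
    by (rule tendsto_mult_left[OF R0])
  have "(LINT z|lborel. complex_of_real (gaussian (z::'a))) = S"
    using gaussian_fourier(2)[of "0::'a"] by (simp add: S_def gaussian_def)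
  moreover have "(LINT \<xi>|lborel. cis (x \<bullet> \<xi>) * fourier F \<xi>) = S * (LINT z|lborel. complex_of_real (gaussian (z::'a)) * F x)"
    using L R unfolding gaussian_regularised_inversion[OF int \<delta>(1)] S_def by (rule LIMSEQ_unique)
  ultimately have "(LINT \<xi>|lborel. cis (x \<bullet> \<xi>) * fourier F \<xi>) = S * S * F x" by simp
  moreover have "S * S = complex_of_real ((2 * pi) ^ DIM('a))"
  proof -
    have "sqrt (2 * pi) ^ DIM('a) * sqrt (2 * pi) ^ DIM('a) = (2 * pi) ^ DIM('a)"
      unfolding power_mult_distrib[symmetric] by (subst real_sqrt_mult_self) simp
    then show ?thesis unfolding S_def of_real_mult[symmetric] by (simp only:)
  qed
  ultimately show ?thesis by (simp add: inv_fourier_def)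
qed

section \<open>Approximate identities tested on boxes\<close>

text \<open>
  The positive and the negative part of \<open>f\<close> are densities of two measures that agree on boxes.
  Boxes form an intersection-stable generator, so the measures, and then the densities, coincide.
\<close>
lemma AE_zero_if_box_integrals_zero_real:
  fixes f :: "'a::euclidean_space \<Rightarrow> real"
  assumes meas[measurable]: "f \<in> borel_measurable borel"
    and int: "\<And>a b. integrable lborel (\<lambda>x. indicator (box a b) x * f x)"
    and zero: "\<And>a b. (LINT x|lborel. indicator (box a b) x * f x) = 0"
  shows "AE x in lborel. f x = 0"
proof -
  \<comment> \<open>The conversion \<open>ennreal\<close> sends negative numbers to zero, so \<open>f\<close> and \<open>- f\<close> yield the two parts.\<close>
  have pos: "emeasure (density lborel (\<lambda>x. ennreal (f x))) (box a b) = (\<integral>\<^sup>+x. ennreal (indicator (box a b) x * f x) \<partial>lborel)" for a b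
    by (subst emeasure_density) (auto intro!: nn_integral_cong split: split_indicator)
  have neg: "emeasure (density lborel (\<lambda>x. ennreal (- f x))) (box a b) = (\<integral>\<^sup>+x. ennreal (- (indicator (box a b) x * f x)) \<partial>lborel)" for a b
    by (subst emeasure_density) (auto intro!: nn_integral_cong split: split_indicator)
  have fin: "(\<integral>\<^sup>+x. ennreal (indicator (box a b) x * f x) \<partial>lborel) < \<infinity>"
      "(\<integral>\<^sup>+x. ennreal (- (indicator (box a b) x * f x)) \<partial>lborel) < \<infinity>" for a b
    using int[of a b] by (auto simp: real_integrable_def less_top)
  have eq: "emeasure (density lborel (\<lambda>x. ennreal (f x))) (box a b)
      = emeasure (density lborel (\<lambda>x. ennreal (- f x))) (box a b)" for a b
    using zero[of a b] fin[of a b] unfolding real_lebesgue_integral_def[OF int] pos neg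
    by (metis ennreal_enn2real eq_iff_diff_eq_0 infinity_ennreal_def)
  have "density lborel (\<lambda>x. ennreal (f x)) = density lborel (\<lambda>x. ennreal (- f x))"
  proof (rule measure_eqI_generator_eq)
    let ?E = "range (\<lambda>(a, b). box a b::'a set)"
    show "Int_stable ?E"
      by (auto simp: Int_stable_def box_Int_box)
    show "?E \<subseteq> Pow UNIV" "sets (density lborel (\<lambda>x. ennreal (f x))) = sigma_sets UNIV ?E"
      "sets (density lborel (\<lambda>x. ennreal (- f x))) = sigma_sets UNIV ?E"
      by (simp_all add: borel_eq_box)
    let ?A = "\<lambda>n::nat. box (- (real n *\<^sub>R One)) (real n *\<^sub>R One) :: 'a set"
    show "range ?A \<subseteq> ?E" "(\<Union>i. ?A i) = UNIV"
      unfolding UN_box_eq_UNIV by auto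
    show "emeasure (density lborel (\<lambda>x. ennreal (f x))) (?A i) \<noteq> \<infinity>" for i
      unfolding pos using fin(1) by (metis less_irrefl)
    show "emeasure (density lborel (\<lambda>x. ennreal (f x))) X = emeasure (density lborel (\<lambda>x. ennreal (- f x))) X"
      if "X \<in> ?E" for X
      using that eq by auto
  qed
  then have "AE x in lborel. ennreal (f x) = ennreal (- f x)"
    by (intro sigma_finite_measure.density_unique sigma_finite_lborel) auto
  then show ?thesis
  proof eventually_elim
    case (elim x)
    then show ?case by (metis ennreal_eq_0_iff ennreal_neg linorder_linear neg_0_le_iff_le neg_le_0_iff_le order_antisym)
  qed
qed

lemma AE_eq_if_box_integrals_eq:
  fixes f g :: "'a::euclidean_space \<Rightarrow> complex"
  assumes int: "\<And>a b. integrable lborel (\<lambda>x. indicator (box a b) x *\<^sub>R f x)"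
      "\<And>a b. integrable lborel (\<lambda>x. indicator (box a b) x *\<^sub>R g x)"
    and [measurable]: "f \<in> borel_measurable borel" "g \<in> borel_measurable borel"
    and eq: "\<And>a b. (LINT x|lborel. indicator (box a b) x *\<^sub>R f x) = (LINT x|lborel. indicator (box a b) x *\<^sub>R g x)"
  shows "AE x in lborel. f x = g x"
proof -
  have int_diff: "integrable lborel (\<lambda>x. indicator (box a b) x *\<^sub>R (f x - g x))" for a b
    using Bochner_Integration.integrable_diff[OF int] by (simp add: scaleR_diff_right)
  have zero: "(LINT x|lborel. indicator (box a b) x *\<^sub>R (f x - g x)) = 0" for a b
    using eq[of a b] Bochner_Integration.integral_diff[OF int, of a b a b] by (simp add: scaleR_diff_right)
  have "AE x in lborel. Re (f x - g x) = 0"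
  proof (rule AE_zero_if_box_integrals_zero_real)
    show "integrable lborel (\<lambda>x. indicator (box a b) x * Re (f x - g x))" for a b
      using integrable_Re[OF int_diff[of a b]] by simp
    show "(LINT x|lborel. indicator (box a b) x * Re (f x - g x)) = 0" for a b
      using integral_Re[OF int_diff[of a b]] zero[of a b] by simp
  qed measurable
  moreover have "AE x in lborel. Im (f x - g x) = 0"
  proof (rule AE_zero_if_box_integrals_zero_real)
    show "integrable lborel (\<lambda>x. indicator (box a b) x * Im (f x - g x))" for a b
      using integrable_Im[OF int_diff[of a b]] by simp
    show "(LINT x|lborel. indicator (box a b) x * Im (f x - g x)) = 0" for a b
      using integral_Im[OF int_diff[of a b]] zero[of a b] by simp
  qed measurable
  ultimately show ?thesis
    by eventually_elim (simp add: complex_eq_iff)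
qed

text \<open>
  Functions dominated by a constant plus an integrable function can be paired with functions that
  are both integrable and bounded: the constant is paired with the \<open>L\<^sup>1\<close> norm of \<open>f\<close> and the
  integrable part with its supremum.
\<close>
lemma
  fixes g f :: "'a::euclidean_space \<Rightarrow> complex"
  assumes gm[measurable]: "g \<in> borel_measurable borel"
    and g: "\<And>x. norm (g x) \<le> B + G x" and G: "integrable lborel G" "\<And>x. 0 \<le> G x" and B: "0 \<le> B"
    and f: "integrable lborel f" "\<And>x. norm (f x) \<le> S"
  shows integrable_mult_sum_space: "integrable lborel (\<lambda>x. g x * f x)"
    and integral_norm_mult_sum_space:
      "(LINT x|lborel. norm (g x * f x)) \<le> B * (LINT x|lborel. norm (f x)) + S * (LINT x|lborel. G x)"
proof -
  note [measurable] = borel_measurable_integrable[OF f(1)]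
  have bound: "norm (g x * f x) \<le> B * norm (f x) + S * G x" for x
  proof -
    have "norm (g x * f x) \<le> (B + G x) * norm (f x)"
      unfolding norm_mult by (intro mult_right_mono g) auto
    also have "\<dots> \<le> B * norm (f x) + S * G x"
      using mult_right_mono[OF f(2)[of x] G(2)[of x]] by (simp add: algebra_simps)
    finally show ?thesis .
  qed
  have maj: "integrable lborel (\<lambda>x. B * norm (f x) + S * G x)"
    using f(1) G(1) by simp
  show int: "integrable lborel (\<lambda>x. g x * f x)"
    by (rule Bochner_Integration.integrable_bound[OF maj])
      (use bound in \<open>auto intro!: AE_I2 order_trans[OF _ abs_ge_self]\<close>)
  have "(LINT x|lborel. norm (g x * f x)) \<le> (LINT x|lborel. B * norm (f x) + S * G x)"
    using int maj bound by (intro integral_mono) auto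
  also have "\<dots> = B * (LINT x|lborel. norm (f x)) + S * (LINT x|lborel. G x)"
    using f(1) G(1) by simp
  finally show "(LINT x|lborel. norm (g x * f x)) \<le> B * (LINT x|lborel. norm (f x)) + S * (LINT x|lborel. G x)" .
qed

definition dilated_kernel :: "('a::euclidean_space \<Rightarrow> complex) \<Rightarrow> real \<Rightarrow> 'a \<Rightarrow> 'a \<Rightarrow> complex" where
  "dilated_kernel h R x y = complex_of_real (R ^ DIM('a)) * h (R *\<^sub>R (y - x))"

lemma
  fixes h :: "'a::euclidean_space \<Rightarrow> complex"
  assumes h: "integrable lborel h" and R: "R > 0"
  shows dilated_kernel_integrable: "integrable lborel (dilated_kernel h R x)"
    and dilated_kernel_norm: "(LINT y|lborel. norm (dilated_kernel h R x y)) = (LINT z|lborel. norm (h z))"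
proof -
  have [measurable]: "h \<in> borel_measurable borel" using borel_measurable_integrable[OF h] by simp
  have "integrable lborel (\<lambda>y. h ((- (R *\<^sub>R x)) + R *\<^sub>R y))"
    using R by (intro lborel_integrable_affine h) simp
  then show "integrable lborel (dilated_kernel h R x)"
    unfolding dilated_kernel_def by (simp add: scaleR_diff_right add.commute)
  have "(LINT z|lborel. norm (h z)) = \<bar>R\<bar> ^ DIM('a) *\<^sub>R (LINT y|lborel. norm (h (- (R *\<^sub>R x) + R *\<^sub>R y)))"
    using R by (intro lborel_integral_affine[of R "\<lambda>z. norm (h z)"]) auto
  then show "(LINT y|lborel. norm (dilated_kernel h R x y)) = (LINT z|lborel. norm (h z))"
    using R by (simp add: dilated_kernel_def norm_mult norm_power scaleR_diff_right)
qed

lemma dilated_kernel_measurable[measurable]: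
  assumes [measurable]: "h \<in> borel_measurable borel"
  shows "(\<lambda>(x, y). dilated_kernel h R x y) \<in> borel_measurable (lborel \<Otimes>\<^sub>M lborel)"
  unfolding dilated_kernel_def by measurable

text \<open>
  After the substitution \<open>x = y - z / R\<close> the dependence on \<open>R\<close> sits in the indicator function, and
  dominated convergence applies with \<open>\<bar>h\<bar>\<close> as majorant.
\<close>
lemma dilated_kernel_box_average:
  fixes h :: "'a::euclidean_space \<Rightarrow> complex"
  assumes [measurable]: "h \<in> borel_measurable borel" and R: "R > 0"
  shows "(LINT x|lborel. indicator (box a b) x *\<^sub>R dilated_kernel h R x y)
    = (LINT z|lborel. indicator (box a b) (y - z /\<^sub>R R) *\<^sub>R h z)"
proof -
  have "(LINT x|lborel. indicator (box a b) x *\<^sub>R dilated_kernel h R x y)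
    = \<bar>- inverse R\<bar> ^ DIM('a) *\<^sub>R (LINT z|lborel. indicator (box a b) (y + (- inverse R) *\<^sub>R z) *\<^sub>R
        dilated_kernel h R (y + (- inverse R) *\<^sub>R z) y)"
    using R unfolding dilated_kernel_def by (intro lborel_integral_affine) auto
  also have "\<dots> = (LINT z|lborel. indicator (box a b) (y - z /\<^sub>R R) *\<^sub>R h z)"
    unfolding integral_scaleR_right[symmetric]
    by (intro Bochner_Integration.integral_cong refl)
      (use R in \<open>auto simp: dilated_kernel_def scaleR_conv_of_real power_mult_distrib[symmetric] split: split_indicator\<close>)
  finally show ?thesis .
qed

lemma indicator_box_shift_tendsto:
  fixes y :: "'a::euclidean_space"
  assumes y: "y \<notin> cbox a b - box a b" and s: "s \<longlonglongrightarrow> y"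
  shows "(\<lambda>n. indicator (box a b) (s n) :: real) \<longlonglongrightarrow> indicator (box a b) y"
proof (cases "y \<in> box a b")
  case True
  then have "\<forall>\<^sub>F n in sequentially. s n \<in> box a b"
    using s by (intro topological_tendstoD open_box)
  then have "\<forall>\<^sub>F n in sequentially. indicator (box a b) (s n) = (indicator (box a b) y :: real)"
    by eventually_elim (use True in simp)
  then show ?thesis by (rule tendsto_eventually)
next
  case False
  then have "y \<in> - cbox a b" using y by auto
  then have "\<forall>\<^sub>F n in sequentially. s n \<in> - cbox a b"
    using s by (intro topological_tendstoD) (auto intro: closed_cbox)
  then have "\<forall>\<^sub>F n in sequentially. indicator (box a b) (s n) = (indicator (box a b) y :: real)"
    by eventually_elim (use False box_subset_cbox[of a b] in \<open>auto simp: indicator_def\<close>)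
  then show ?thesis by (rule tendsto_eventually)
qed

text \<open>
  If the pairings of \<open>g\<close> with the kernel around \<open>x\<close> do not depend on the scale \<open>R \<ge> r\<close>, then they
  equal their limit for \<open>R \<rightarrow> \<infinity>\<close>, which is a multiple of \<open>g\<close>. For a merely
  measurable \<open>g\<close> this limit is not pointwise, so \<open>w\<close> is integrated over a box and the kernel is moved
  onto the indicator of the box. The averages of the indicator converge off the boundary of the
  box, which is a null set.
  
  Half of the decay of order \<open>4 d\<close> makes \<open>(1 + \<bar>z\<bar>)\<^sup>2\<^sup>d h(z)\<close> integrable; the other half is used up in
  showing that the averages decay like \<open>decay_weight\<close>, uniformly in \<open>R \<ge> 1\<close>.
\<close>
lemma dilated_kernel_reproduces:
  fixes g h :: "'a::euclidean_space \<Rightarrow> complex"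
  assumes hm[measurable]: "h \<in> borel_measurable borel"
    and decay: "\<And>z. (1 + norm z) ^ (4 * DIM('a)) * norm (h z) \<le> C"
    and gm[measurable]: "g \<in> borel_measurable borel"
    and g: "\<And>x. norm (g x) \<le> B + G x" and G: "integrable lborel G" "\<And>x. 0 \<le> G x" and B: "0 \<le> B"
    and const: "\<And>R x. R \<ge> r \<Longrightarrow> (LINT y|lborel. g y * dilated_kernel h R x y) = w x"
  shows "AE x in lborel. w x = (LINT z|lborel. h z) * g x"
proof -
  have C: "C \<ge> 0" using order_trans[OF _ decay[of 0]] by simp
  have h_le: "(1 + norm z) ^ (2 * DIM('a)) * norm (h z) \<le> C * decay_weight z" for z
  proof -
    have "(1 + norm z) ^ (4 * DIM('a)) = (1 + norm z) ^ (2 * DIM('a)) * (1 + norm z) ^ (2 * DIM('a))"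
      by (simp add: power_add[symmetric])
    then show ?thesis using decay[of z] unfolding decay_weight_def
      by (simp add: pos_le_divide_eq add_pos_nonneg mult_ac)
  qed
  have one_le: "1 \<le> (1 + norm z) ^ k" for z :: 'a and k by (intro one_le_power) simp
  have h_bdd: "norm (h z) \<le> C" for z
    using decay[of z] mult_right_mono[OF one_le[of z "4 * DIM('a)"] norm_ge_zero[of "h z"]] by simp
  have h_wt: "norm (h z) \<le> (1 + norm z) ^ (2 * DIM('a)) * norm (h z)" for z
    using mult_right_mono[OF one_le[of z "2 * DIM('a)"] norm_ge_zero[of "h z"]] by simp
  have int_hw: "integrable lborel (\<lambda>z. (1 + norm z) ^ (2 * DIM('a)) * norm (h z))"
    by (rule Bochner_Integration.integrable_bound[OF integrable_mult_right[OF integrable_decay_weight, of C]])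
      (use h_le C in \<open>auto simp: decay_weight_nonneg\<close>)
  have int_h: "integrable lborel h"
    by (rule Bochner_Integration.integrable_bound[OF int_hw])
      (use h_wt in \<open>auto intro!: AE_I2 order_trans[OF _ abs_ge_self]\<close>)
  define H where "H = (LINT z|lborel. h z)"
  define R where "R n = max r 1 + real n" for n
  have R: "R n \<ge> r" "R n \<ge> 1" "R n > 0" for n by (auto simp: R_def)
  have R_lim: "(\<lambda>n. inverse (R n)) \<longlonglongrightarrow> 0"
    unfolding R_def by (intro tendsto_inverse_0_at_top filterlim_tendsto_add_at_top[OF tendsto_const]
      filterlim_real_sequentially)
  have k_bdd: "norm (dilated_kernel h (R n) x y) \<le> R n ^ DIM('a) * C" for n x y
    using R(3)[of n] h_bdd by (simp add: dilated_kernel_def norm_mult norm_power)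
  note k_int = dilated_kernel_integrable[OF int_h R(3)]
  have gk_int: "integrable lborel (\<lambda>y. g y * dilated_kernel h (R n) x y)" for n x
    by (rule integrable_mult_sum_space[OF gm g G B k_int k_bdd])
  define W where "W = B * (LINT z|lborel. norm (h z)) + R 0 ^ DIM('a) * C * (LINT x|lborel. G x)"
  have gk_norm: "(LINT y|lborel. norm (g y * dilated_kernel h (R n) x y))
      \<le> B * (LINT z|lborel. norm (h z)) + R n ^ DIM('a) * C * (LINT x|lborel. G x)" for n x
    using integral_norm_mult_sum_space[OF gm g G B k_int k_bdd, of n x]
    unfolding dilated_kernel_norm[OF int_h R(3)] .
  have w_eq: "w x = (LINT y|lborel. g y * dilated_kernel h (R n) x y)" for n x
    using const[OF R(1)] by simp
  have w_bdd: "norm (w x) \<le> W" for x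
    using order_trans[OF integral_norm_bound gk_norm, of 0 x] unfolding w_eq[of x 0] W_def .
  have [measurable]: "w \<in> borel_measurable borel"
  proof -
    have "(\<lambda>x. LINT y|lborel. g y * dilated_kernel h (R 0) x y) \<in> borel_measurable lborel"
      by measurable
    then show ?thesis unfolding w_eq[of _ 0, symmetric] by simp
  qed
  have box_int: "integrable lborel (\<lambda>x. complex_of_real (indicator (box a b) x))" for a b :: 'a
    using emeasure_lborel_box_finite[of a b] by (intro integrable_of_real integrable_real_indicator) auto
  have "AE x in lborel. w x = H * g x"
  proof (rule AE_eq_if_box_integrals_eq)
    fix a b :: 'a
    have "integrable lborel (\<lambda>x. g x * complex_of_real (indicator (box a b) x))"
      by (rule integrable_mult_sum_space[OF gm g G B box_int, where S = 1]) (auto split: split_indicator)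
    from integrable_mult_right[OF this, of H]
    show "integrable lborel (\<lambda>x. indicator (box a b) x *\<^sub>R (H * g x))"
      by (simp add: scaleR_conv_of_real mult_ac)
    have "integrable lborel (\<lambda>x. w x * complex_of_real (indicator (box a b) x))"
      by (rule integrable_mult_sum_space[of w W "\<lambda>_. 0", OF _ _ _ _ _ box_int, where S = 1])
        (use w_bdd order_trans[OF norm_ge_zero w_bdd] in \<open>auto split: split_indicator\<close>)
    then show "integrable lborel (\<lambda>x. indicator (box a b) x *\<^sub>R w x)"
      by (simp add: scaleR_conv_of_real mult_ac)
    define K where "K n y = (LINT z|lborel. indicator (box a b) (y - z /\<^sub>R R n) *\<^sub>R h z)" for n y
    have box_w: "(LINT x|lborel. indicator (box a b) x *\<^sub>R w x) = (LINT y|lborel. g y * K n y)" for n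
    proof -
      have "(LINT x|lborel. indicator (box a b) x *\<^sub>R w x)
          = (LINT x|lborel. (LINT y|lborel. indicator (box a b) x *\<^sub>R (g y * dilated_kernel h (R n) x y)))"
        unfolding w_eq[of _ n] by simp
      also have "\<dots> = (LINT y|lborel. (LINT x|lborel. indicator (box a b) x *\<^sub>R (g y * dilated_kernel h (R n) x y)))"
      proof (rule lborel_Fubini_swap[symmetric])
        let ?b = "B * (LINT z|lborel. norm (h z)) + R n ^ DIM('a) * C * (LINT x|lborel. G x)"
        show "integrable lborel (\<lambda>x. ?b * indicator (box a b) x)"
          using emeasure_lborel_box_finite[of a b] by (intro integrable_mult_right integrable_real_indicator) auto
        show "integrable lborel (\<lambda>y. indicator (box a b) x *\<^sub>R (g y * dilated_kernel h (R n) x y))" for x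
          using gk_int by simp
        show "(LINT y|lborel. norm (indicator (box a b) x *\<^sub>R (g y * dilated_kernel h (R n) x y)))
            \<le> ?b * indicator (box a b) x" for x
          using gk_norm[of n x] by (auto split: split_indicator)
      qed measurable
      also have "\<dots> = (LINT y|lborel. g y * (LINT x|lborel. indicator (box a b) x *\<^sub>R dilated_kernel h (R n) x y))"
        unfolding integral_mult_right_zero[symmetric]
        by (intro Bochner_Integration.integral_cong refl) (simp add: scaleR_conv_of_real mult_ac)
      finally show ?thesis unfolding dilated_kernel_box_average[OF hm R(3)] K_def .
    qed
    obtain \<rho> where \<rho>: "\<rho> > 0" "\<And>x. x \<in> box a b \<Longrightarrow> norm x \<le> \<rho>"
      using bounded_box[of a b] unfolding bounded_pos by auto
    define D where "D = (1 + \<rho>) ^ (2 * DIM('a)) * (LINT z|lborel. (1 + norm z) ^ (2 * DIM('a)) * norm (h z))"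
    have D: "D \<ge> 0" unfolding D_def using \<rho>(1) by (intro mult_nonneg_nonneg integral_nonneg_AE) auto
    \<comment> \<open>If \<open>y - z / R\<close> is in the box and \<open>R \<ge> 1\<close>, then \<open>1 + \<bar>y\<bar> \<le> (1 + \<rho>) (1 + \<bar>z\<bar>)\<close>: decay in \<open>z\<close> becomes decay in \<open>y\<close>.\<close>
    have K_le: "norm (K n y) \<le> D * decay_weight y" for n y
    proof -
      have "norm (K n y) \<le> (LINT z|lborel. (1 + \<rho>) ^ (2 * DIM('a)) * decay_weight y * ((1 + norm z) ^ (2 * DIM('a)) * norm (h z)))"
        unfolding K_def
      proof (rule Bochner_Integration.integral_norm_bound_integral)
        show "integrable lborel (\<lambda>z. indicator (box a b) (y - z /\<^sub>R R n) *\<^sub>R h z)"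
          by (rule Bochner_Integration.integrable_bound[OF int_h]) (auto split: split_indicator)
        show "integrable lborel (\<lambda>z. (1 + \<rho>) ^ (2 * DIM('a)) * decay_weight y * ((1 + norm z) ^ (2 * DIM('a)) * norm (h z)))"
          by (intro integrable_mult_right int_hw)
      next
        fix z :: 'a
        show "norm (indicator (box a b) (y - z /\<^sub>R R n) *\<^sub>R h z)
            \<le> (1 + \<rho>) ^ (2 * DIM('a)) * decay_weight y * ((1 + norm z) ^ (2 * DIM('a)) * norm (h z))"
        proof (cases "y - z /\<^sub>R R n \<in> box a b")
          case True
          have "norm (z /\<^sub>R R n) \<le> norm z"
            using R(2)[of n] by (simp add: divide_simps mult_le_cancel_left1)
          then have "norm y \<le> \<rho> + norm z"
            using norm_triangle_ineq[of "y - z /\<^sub>R R n" "z /\<^sub>R R n"] \<rho>(2)[OF True] by simp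
          also have "1 + (\<rho> + norm z) \<le> (1 + \<rho>) * (1 + norm z)"
            using \<rho>(1) by (simp add: algebra_simps)
          finally have "(1 + norm y) ^ (2 * DIM('a)) \<le> ((1 + \<rho>) * (1 + norm z)) ^ (2 * DIM('a))"
            by (intro power_mono) auto
          then have "1 \<le> (1 + \<rho>) ^ (2 * DIM('a)) * decay_weight y * (1 + norm z) ^ (2 * DIM('a))"
            unfolding decay_weight_def power_mult_distrib by (simp add: pos_le_divide_eq add_pos_nonneg)
          from mult_right_mono[OF this norm_ge_zero[of "h z"]] show ?thesis using True by (simp add: mult_ac)
        next
          case False
          then show ?thesis using \<rho>(1) by (simp add: decay_weight_nonneg)
        qed
      qed
      also have "\<dots> = D * decay_weight y" by (simp add: D_def)
      finally show ?thesis .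
    qed
    have K_lim: "(\<lambda>n. K n y) \<longlonglongrightarrow> indicator (box a b) y *\<^sub>R H" if y: "y \<notin> cbox a b - box a b" for y
    proof -
      have "(\<lambda>n. K n y) \<longlonglongrightarrow> (LINT z|lborel. indicator (box a b) y *\<^sub>R h z)"
        unfolding K_def
      proof (rule integral_dominated_convergence[where w = "\<lambda>z. norm (h z)"])
        show "AE z in lborel. (\<lambda>n. indicator (box a b) (y - z /\<^sub>R R n) *\<^sub>R h z) \<longlonglongrightarrow> indicator (box a b) y *\<^sub>R h z"
        proof (rule AE_I2)
          fix z :: 'a
          have "(\<lambda>n. y - inverse (R n) *\<^sub>R z) \<longlonglongrightarrow> y - 0 *\<^sub>R z"
            by (intro tendsto_intros R_lim)
          then have "(\<lambda>n. y - z /\<^sub>R R n) \<longlonglongrightarrow> y" by simp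
          from indicator_box_shift_tendsto[OF y this]
          show "(\<lambda>n. indicator (box a b) (y - z /\<^sub>R R n) *\<^sub>R h z) \<longlonglongrightarrow> indicator (box a b) y *\<^sub>R h z"
            by (intro tendsto_intros)
        qed
      qed (use int_h in \<open>auto split: split_indicator\<close>)
      then show ?thesis by (simp add: H_def)
    qed
    have "(\<lambda>n. LINT y|lborel. g y * K n y) \<longlonglongrightarrow> (LINT y|lborel. g y * (indicator (box a b) y *\<^sub>R H))"
    proof (rule integral_dominated_convergence[where w = "\<lambda>y. norm (g y * complex_of_real (D * decay_weight y))"])
      have "norm (complex_of_real (D * decay_weight (y::'a))) \<le> D" for y
      proof -
        have "decay_weight y \<le> 1" using one_le[of y "2 * DIM('a)"] by (simp add: decay_weight_def divide_le_eq)
        then show ?thesis using D mult_left_mono[of "decay_weight y" 1 D]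
          unfolding norm_of_real by (simp add: decay_weight_nonneg)
      qed
      then show "integrable lborel (\<lambda>y. norm (g y * complex_of_real (D * decay_weight y)))"
        by (intro integrable_norm integrable_mult_sum_space[OF gm g G B] integrable_of_real
          integrable_mult_right integrable_decay_weight)
      show "AE y in lborel. (\<lambda>n. g y * K n y) \<longlonglongrightarrow> g y * (indicator (box a b) y *\<^sub>R H)"
        using AE_not_in[OF null_sets_cbox_Diff_box[of a b]]
        by eventually_elim (intro tendsto_intros K_lim)
      show "AE y in lborel. norm (g y * K n y) \<le> norm (g y * complex_of_real (D * decay_weight y))" for n
        using K_le D by (auto simp: norm_mult decay_weight_nonneg intro!: mult_left_mono)
      show "(\<lambda>y. g y * K n y) \<in> borel_measurable lborel" for n
        unfolding K_def by measurable
    qed measurable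
    then have "(\<lambda>n::nat. LINT x|lborel. indicator (box a b) x *\<^sub>R w x) \<longlonglongrightarrow> (LINT y|lborel. g y * (indicator (box a b) y *\<^sub>R H))"
      unfolding box_w[symmetric] .
    then show "(LINT x|lborel. indicator (box a b) x *\<^sub>R w x) = (LINT x|lborel. indicator (box a b) x *\<^sub>R (H * g x))"
      by (simp add: LIMSEQ_const_iff mult_ac)
  qed measurable
  then show ?thesis by (simp add: H_def)
qed

section \<open>Suprema of functions with bounded spectrum\<close>

lemma cutoff_ball_test_function:
  assumes "cutoff \<eta>"
  shows "(\<lambda>\<xi>. complex_of_real (\<eta> \<xi>)) \<in> ball_test_functions"
  using assms smooth_of_real[of \<eta>] by (auto simp: cutoff_def ball_test_functions_def)

lemma fourier_ball_test_integrable: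
  fixes F :: "'a::euclidean_space \<Rightarrow> complex"
  assumes F: "F \<in> ball_test_functions"
  shows "integrable lborel (fourier F)"
proof -
  obtain C where C: "\<And>\<xi>. (1 + norm \<xi>) ^ (2 * DIM('a)) * norm (fourier F \<xi>) \<le> C"
    using fourier_decay[OF F] by blast
  have "smooth (fourier F)" using fourier_schwartz[OF F] by (simp add: schwartz_def)
  then have [measurable]: "fourier F \<in> borel_measurable borel"
    by (intro borel_measurable_continuous_onI smooth_continuous_on)
  have "norm (fourier F \<xi>) \<le> C * decay_weight \<xi>" for \<xi>
    using C[of \<xi>] by (simp add: decay_weight_def pos_le_divide_eq add_pos_nonneg mult.commute)
  then have "norm (fourier F \<xi>) \<le> norm (C * decay_weight \<xi>)" for \<xi>
    unfolding real_norm_def by (rule order_trans[OF _ abs_ge_self])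
  then show ?thesis
    by (intro Bochner_Integration.integrable_bound[OF integrable_mult_right[OF integrable_decay_weight, of C]]) auto
qed

lemma inv_fourier_fourier_ball_test:
  assumes F: "F \<in> ball_test_functions"
  shows "inv_fourier (fourier F) x = F x"
proof -
  obtain B where "\<And>x. norm (F x) \<le> B" using ball_test_functions_bounded[OF F] by blast
  then show ?thesis
    using F by (intro fourier_inversion fourier_ball_test_integrable ball_test_functions_integrable)
      (auto simp: ball_test_functions_def smooth_continuous_on)
qed

lemma inv_fourier_dilated_kernel:
  fixes h :: "'a::euclidean_space \<Rightarrow> complex"
  assumes [measurable]: "h \<in> borel_measurable borel" and R: "R > 0"
  shows "inv_fourier (dilated_kernel h R x) \<xi> = cis (x \<bullet> \<xi>) * inv_fourier h (\<xi> /\<^sub>R R)"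
proof -
  have "(LINT y|lborel. cis (\<xi> \<bullet> y) * dilated_kernel h R x y)
    = \<bar>inverse R\<bar> ^ DIM('a) *\<^sub>R (LINT z|lborel. cis (\<xi> \<bullet> (x + inverse R *\<^sub>R z)) * dilated_kernel h R x (x + inverse R *\<^sub>R z))"
    using R unfolding dilated_kernel_def by (intro lborel_integral_affine) auto
  also have "\<dots> = (LINT z|lborel. cis (x \<bullet> \<xi>) * (cis ((\<xi> /\<^sub>R R) \<bullet> z) * h z))"
    unfolding integral_scaleR_right[symmetric]
  proof (intro Bochner_Integration.integral_cong refl)
    fix z :: 'a
    have "cis (\<xi> \<bullet> (x + inverse R *\<^sub>R z)) = cis (x \<bullet> \<xi>) * cis ((\<xi> /\<^sub>R R) \<bullet> z)"
      by (simp add: cis_mult inner_add_right inner_commute)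
    moreover have "\<bar>inverse R\<bar> ^ DIM('a) *\<^sub>R dilated_kernel h R x (x + inverse R *\<^sub>R z) = h z"
      using R by (simp add: dilated_kernel_def scaleR_conv_of_real power_mult_distrib[symmetric]
          of_real_mult[symmetric] mult.assoc[symmetric] del: of_real_mult of_real_power)
    ultimately show "\<bar>inverse R\<bar> ^ DIM('a) *\<^sub>R (cis (\<xi> \<bullet> (x + inverse R *\<^sub>R z)) * dilated_kernel h R x (x + inverse R *\<^sub>R z))
        = cis (x \<bullet> \<xi>) * (cis ((\<xi> /\<^sub>R R) \<bullet> z) * h z)"
      by (metis mult.assoc mult_scaleR_right)
  qed
  finally show ?thesis by (simp add: inv_fourier_def)
qed

text \<open>
  A Bernstein-type inequality for a distribution with symbol \<open>m\<close> supported in the ball of radius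
  \<open>\<rho>\<close>. The bound comes from the averaging identity at the smallest admissible scale
  \<open>r = 4 \<rho> / 3\<close>, with \<open>B\<close> paired with the \<open>L\<^sup>1\<close> norm and \<open>G\<close> with the supremum of the kernel. The
  constant \<open>K\<close> depends on the cutoff only, which lets one constant serve all dyadic blocks.
\<close>
theorem band_limited_sup_bound:
  fixes \<eta> :: "'a::euclidean_space \<Rightarrow> real"
  assumes \<eta>: "cutoff \<eta>"
  shows "\<exists>K>0. \<forall>\<rho>>0. \<forall>(m :: 'a \<Rightarrow> real) u g B G.
    (\<forall>\<xi>. norm \<xi> > \<rho> \<longrightarrow> m \<xi> = 0) \<longrightarrow>
    represents g (dist_inv_fourier (dist_mult m (dist_fourier u))) \<longrightarrow>
    (\<forall>x. norm (g x) \<le> B + G x) \<longrightarrow> 0 \<le> B \<longrightarrow> integrable lborel G \<longrightarrow> (\<forall>x. 0 \<le> G x) \<longrightarrow>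
    (AE x in lborel. norm (g x) \<le> K * (B + \<rho> ^ DIM('a) * (LINT x|lborel. G x)))"
proof -
  define E where "E \<xi> = complex_of_real (\<eta> \<xi>)" for \<xi>
  define h where "h = fourier E"
  have E: "E \<in> ball_test_functions" unfolding E_def by (rule cutoff_ball_test_function[OF \<eta>])
  have h_int: "integrable lborel h" unfolding h_def by (rule fourier_ball_test_integrable[OF E])
  then have [measurable]: "h \<in> borel_measurable borel" using borel_measurable_integrable by simp
  have h_schwartz: "h \<in> schwartz" unfolding h_def by (rule fourier_schwartz[OF E])
  have inv_h: "inv_fourier h \<xi> = E \<xi>" for \<xi> unfolding h_def by (rule inv_fourier_fourier_ball_test[OF E])
  obtain C where C: "\<And>z. (1 + norm z) ^ (4 * DIM('a)) * norm (h z) \<le> C"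
    using fourier_decay[OF E] unfolding h_def by blast
  have C0: "C \<ge> 0" using order_trans[OF _ C[of 0]] by simp
  have h_bdd: "norm (h z) \<le> C" for z
    using C[of z] mult_right_mono[OF one_le_power[of "1 + norm z" "4 * DIM('a)"] norm_ge_zero[of "h z"]] by simp
  define H where "H = (LINT z|lborel. h z)"
  have "E 0 = 1" using \<eta> by (simp add: E_def cutoff_def)
  with inv_h[of 0] have H: "H = complex_of_real ((2 * pi) ^ DIM('a))"
    by (simp add: inv_fourier_def H_def field_simps)
  have "1 \<le> 2 * pi" using pi_gt3 by linarith
  then have "1 \<le> (2 * pi) ^ DIM('a)" by (rule one_le_power)
  then have normH: "1 \<le> norm H" unfolding H norm_of_real by (rule order_trans[OF _ abs_ge_self])
  define K where "K = (LINT z|lborel. norm (h z)) + (4 / 3) ^ DIM('a) * C + 1"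
  have L1: "0 \<le> (LINT z|lborel. norm (h z))" by simp
  have "K > 0" unfolding K_def using L1 C0 by (intro add_nonneg_pos add_nonneg_nonneg) auto
  moreover have "AE x in lborel. norm (g x) \<le> K * (B + \<rho> ^ DIM('a) * (LINT x|lborel. G x))"
    if \<rho>: "\<rho> > 0" and m: "\<And>\<xi>. norm \<xi> > \<rho> \<Longrightarrow> m \<xi> = 0"
      and g: "represents g (dist_inv_fourier (dist_mult m (dist_fourier u)))"
      and gBG: "\<And>x. norm (g x) \<le> B + G x" and B: "0 \<le> B" and G: "integrable lborel G" "\<And>x. 0 \<le> G x"
    for \<rho> B and m :: "'a \<Rightarrow> real" and u and g :: "'a \<Rightarrow> complex" and G :: "'a \<Rightarrow> real"
  proof -
    \<comment> \<open>The cutoff equals one on the ball of radius \<open>3 / 4\<close>; dilated by \<open>r\<close>, this ball has radius \<open>\<rho>\<close>.\<close>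
    define r where "r = 4 / 3 * \<rho>"
    have r: "r > 0" using \<rho> by (simp add: r_def)
    have [measurable]: "g \<in> borel_measurable borel" using g by (simp add: represents_def)
    define w where "w x = u (fourier (\<lambda>\<xi>. complex_of_real (m \<xi>) * cis (x \<bullet> \<xi>)))" for x
    \<comment> \<open>The kernel enters only through \<open>m\<close> times its inverse transform, in which \<open>R\<close> no longer appears.\<close>
    have pairing: "(LINT y|lborel. g y * dilated_kernel h R x y) = w x" if R: "R \<ge> r" for R x
    proof -
      have "R > 0" using R r by simp
      have "dilated_kernel h R x \<in> schwartz"
        unfolding dilated_kernel_def using \<open>R > 0\<close> by (intro schwartz_affine h_schwartz) simp
      then have "(LINT y|lborel. g y * dilated_kernel h R x y)
          = u (fourier (\<lambda>\<xi>. complex_of_real (m \<xi>) * inv_fourier (dilated_kernel h R x) \<xi>))"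
        using g by (simp add: represents_def dist_inv_fourier_def dist_mult_def dist_fourier_def)
      moreover have "complex_of_real (m \<xi>) * inv_fourier (dilated_kernel h R x) \<xi> = complex_of_real (m \<xi>) * cis (x \<bullet> \<xi>)" for \<xi>
      proof (cases "norm \<xi> > \<rho>")
        case False
        then have "norm (\<xi> /\<^sub>R R) \<le> 3 / 4"
          using \<open>R > 0\<close> R by (simp add: r_def field_simps)
        then have "E (\<xi> /\<^sub>R R) = 1" using \<eta> by (simp add: E_def cutoff_def)
        then show ?thesis using \<open>R > 0\<close> by (simp add: inv_fourier_dilated_kernel inv_h)
      qed (simp add: m)
      ultimately show ?thesis by (simp add: w_def)
    qed
    have w_le: "norm (w x) \<le> K * (B + \<rho> ^ DIM('a) * (LINT x|lborel. G x))" for x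
    proof -
      have "norm (w x) \<le> (LINT y|lborel. norm (g y * dilated_kernel h r x y))"
        unfolding pairing[OF order_refl, symmetric] by (rule integral_norm_bound)
      also have "\<dots> \<le> B * (LINT y|lborel. norm (dilated_kernel h r x y)) + r ^ DIM('a) * C * (LINT x|lborel. G x)"
        by (rule integral_norm_mult_sum_space[OF _ gBG G B dilated_kernel_integrable[OF h_int r]])
          (use h_bdd r in \<open>auto simp: dilated_kernel_def norm_mult norm_power\<close>)
      also have "\<dots> = B * (LINT z|lborel. norm (h z)) + (4 / 3) ^ DIM('a) * C * (\<rho> ^ DIM('a) * (LINT x|lborel. G x))"
        unfolding dilated_kernel_norm[OF h_int r] unfolding r_def power_mult_distrib by simp
      also have "\<dots> \<le> B * K + K * (\<rho> ^ DIM('a) * (LINT x|lborel. G x))"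
        using B \<rho> G(2) C0 L1 by (intro add_mono mult_left_mono mult_right_mono) (auto simp: K_def)
      finally show ?thesis by (simp add: algebra_simps)
    qed
    have "AE x in lborel. w x = H * g x"
      unfolding H_def by (rule dilated_kernel_reproduces[OF _ C _ gBG G B pairing]) auto
    then show ?thesis
    proof eventually_elim
      case (elim x)
      have "norm (g x) \<le> norm H * norm (g x)" using mult_right_mono[OF normH norm_ge_zero[of "g x"]] by simp
      also have "\<dots> = norm (w x)" by (simp add: elim norm_mult)
      finally show ?case using w_le by (rule order_trans)
    qed
  qed
  ultimately show ?thesis by blast
qed

section \<open>Orlicz bounds\<close>

text \<open>
  All three properties come from the density \<open>a\<close> being nondecreasing. For the last one,
  \<open>A s \<le> s * a s\<close> and \<open>A t - A s \<ge> (t - s) * a s\<close>, which says that \<open>A(t) / t\<close> is nondecreasing.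
\<close>
lemma
  assumes "N_function A"
  shows N_function_nonneg: "t \<ge> 0 \<Longrightarrow> 0 \<le> A t"
    and N_function_mono: "mono_on {0..} A"
    and N_function_superlinear: "\<lbrakk>0 < s; s \<le> t\<rbrakk> \<Longrightarrow> A s * t \<le> A t * s"
proof -
  obtain a where mono: "mono_on {0..} a" and "a 0 = 0" and A: "\<And>t. t \<ge> 0 \<Longrightarrow> A t = integral {0..t} a"
    using assms unfolding N_function_def by blast
  have a_mono: "a x \<le> a y" if "0 \<le> x" "x \<le> y" for x y
    using mono that by (auto simp: mono_on_def)
  then have a_nonneg: "0 \<le> a x" if "0 \<le> x" for x using \<open>a 0 = 0\<close> that by fastforce
  have int: "a integrable_on {x..y}" if "0 \<le> x" for x y
    by (rule integrable_on_mono_on) (use mono that in \<open>auto simp: mono_on_def\<close>)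
  have upper: "integral {x..y} a \<le> (y - x) * a y" if "0 \<le> x" "x \<le> y" for x y
  proof -
    have "integral {x..y} a \<le> integral {x..y} (\<lambda>_. a y)"
      using that by (intro integral_le int) (auto intro: a_mono)
    then show ?thesis using that by simp
  qed
  have lower: "(y - x) * a x \<le> integral {x..y} a" if "0 \<le> x" "x \<le> y" for x y
  proof -
    have "integral {x..y} (\<lambda>_. a x) \<le> integral {x..y} a"
      using that by (intro integral_le int) (auto intro: a_mono)
    then show ?thesis using that by simp
  qed
  have split: "A y = A x + integral {x..y} a" if "0 \<le> x" "x \<le> y" for x y
    using Henstock_Kurzweil_Integration.integral_combine[of 0 x y a] that int[of 0] A by simp
  show nonneg: "0 \<le> A t" if "t \<ge> 0" for t
    using lower[of 0 t] that A[of t] \<open>a 0 = 0\<close> by simp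
  show "mono_on {0..} A"
  proof (rule mono_onI)
    fix x y :: real assume xy: "x \<in> {0..}" "y \<in> {0..}" "x \<le> y"
    then have "0 \<le> (y - x) * a x" using a_nonneg[of x] by simp
    with lower[of x y] split[of x y] xy show "A x \<le> A y" by simp
  qed
  show "A s * t \<le> A t * s" if "0 < s" "s \<le> t"
  proof -
    have "A s * (t - s) \<le> (s * a s) * (t - s)"
      using upper[of 0 s] A[of s] that by (intro mult_right_mono) auto
    also have "\<dots> = ((t - s) * a s) * s" by simp
    also have "\<dots> \<le> integral {s..t} a * s"
      using lower[of s t] that by (intro mult_right_mono) auto
    also have "\<dots> = A t * s - A s * s" using split[of s t] that by (simp add: algebra_simps)
    finally show ?thesis by (simp add: algebra_simps)
  qed
qed

text \<open>
  Where \<open>\<bar>g\<bar> \<le> \<kappa> s\<close> the constant suffices; elsewhere monotonicity of \<open>A(t) / t\<close> gives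
  \<open>\<bar>g\<bar> / \<kappa> \<le> (s / A(s)) A(\<bar>g\<bar> / \<kappa>)\<close>, and the integral of the right-hand side is controlled by the
  modular.
\<close>
lemma luxemburg_splitting:
  fixes g :: "'a::euclidean_space \<Rightarrow> complex"
  assumes A: "N_function A" and [measurable]: "g \<in> borel_measurable borel"
    and \<kappa>: "\<kappa> > 0" and modular: "(\<integral>\<^sup>+x. ennreal (A (norm (g x) / \<kappa>)) \<partial>lborel) \<le> 1"
    and s: "s > 0" "A s > 0"
  obtains G where "integrable lborel G" "\<And>x. 0 \<le> G x" "\<And>x. norm (g x) \<le> \<kappa> * s + G x"
    "(LINT x|lborel. G x) \<le> \<kappa> * s / A s"
proof
  have "mono (\<lambda>t. A (max 0 t))"
    using N_function_mono[OF A] by (auto simp: mono_def mono_on_def)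
  from borel_measurable_mono[OF this]
  have "(\<lambda>x. A (max 0 (norm (g x) / \<kappa>))) \<in> borel_measurable borel" by measurable
  then have meas[measurable]: "(\<lambda>x. A (norm (g x) / \<kappa>)) \<in> borel_measurable borel"
    using \<kappa> by (simp add: max_def)
  have nn: "0 \<le> A (norm (g x) / \<kappa>)" for x using N_function_nonneg[OF A] \<kappa> by simp
  have "(\<integral>\<^sup>+x. ennreal (A (norm (g x) / \<kappa>)) \<partial>lborel) < \<infinity>"
    using modular by (simp add: order_le_less_trans)
  then have int: "integrable lborel (\<lambda>x. A (norm (g x) / \<kappa>))"
    by (intro integrableI_nonneg) (auto simp: nn)
  have le1: "(LINT x|lborel. A (norm (g x) / \<kappa>)) \<le> 1"
    using modular nn nn_integral_eq_integral[OF int] by simp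
  let ?G = "\<lambda>x. \<kappa> * s / A s * A (norm (g x) / \<kappa>)"
  show "integrable lborel ?G" using int by simp
  show "0 \<le> ?G x" for x using nn \<kappa> s by simp
  show "norm (g x) \<le> \<kappa> * s + ?G x" for x
  proof (cases "norm (g x) / \<kappa> \<le> s")
    case True
    then have "norm (g x) \<le> \<kappa> * s" using \<kappa> by (simp add: field_simps)
    with nn[of x] \<kappa> s show ?thesis by (simp add: add_increasing2)
  next
    case False
    then have "A s * (norm (g x) / \<kappa>) \<le> A (norm (g x) / \<kappa>) * s"
      using s by (intro N_function_superlinear[OF A]) auto
    then have "norm (g x) \<le> ?G x" using \<kappa> s by (simp add: field_simps)
    with \<kappa> s show ?thesis by (simp add: add_increasing)
  qed
  have "(LINT x|lborel. ?G x) = \<kappa> * s / A s * (LINT x|lborel. A (norm (g x) / \<kappa>))" by simp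
  also have "\<dots> \<le> \<kappa> * s / A s * 1" using \<kappa> s le1 by (intro mult_left_mono) auto
  finally show "(LINT x|lborel. ?G x) \<le> \<kappa> * s / A s" by simp
qed

lemma ennreal_le_cmult_Inf:
  fixes X :: "ennreal set" and c :: real
  assumes c: "c > 0" and le: "\<And>x. x \<in> X \<Longrightarrow> a \<le> ennreal c * x"
  shows "a \<le> ennreal c * Inf X"
proof -
  have "a / ennreal c \<le> Inf X"
    using c le by (intro Inf_greatest divide_le_posI_ennreal) (auto simp: mult.commute)
  then have "ennreal c * (a / ennreal c) \<le> ennreal c * Inf X" by (intro mult_left_mono) auto
  moreover have "ennreal c * (a / ennreal c) = a"
    using c by (simp add: ennreal_times_divide mult_divide_eq_ennreal mult.commute)
  ultimately show ?thesis by simp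
qed

text \<open>
  At a level \<open>s\<close> with \<open>A(s) \<ge> \<rho>\<^sup>d\<close> the integrable part of the splitting contributes
  \<open>\<rho>\<^sup>d \<kappa> s / A(s) \<le> \<kappa> s\<close>, no more than the bounded part.
\<close>
corollary band_limited_sup_luxemburg:
  fixes \<eta> :: "'a::euclidean_space \<Rightarrow> real"
  assumes \<eta>: "cutoff \<eta>" and A: "N_function A"
  obtains K where "K > 0" and "\<And>\<rho> s (m :: 'a \<Rightarrow> real) u. \<lbrakk>\<rho> > 0; s > 0; \<rho> ^ DIM('a) \<le> A s; \<And>\<xi>. norm \<xi> > \<rho> \<Longrightarrow> m \<xi> = 0\<rbrakk> \<Longrightarrow>
     distribution_norm sup_norm (dist_inv_fourier (dist_mult m (dist_fourier u)))
     \<le> ennreal (K * s) * distribution_norm (luxemburg_norm A) (dist_inv_fourier (dist_mult m (dist_fourier u)))"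
proof -
  obtain K where K: "K > 0" and bound: "\<And>\<rho> (m :: 'a \<Rightarrow> real) u g B G. \<lbrakk>\<rho> > 0; \<And>\<xi>. norm \<xi> > \<rho> \<Longrightarrow> m \<xi> = 0;
    represents g (dist_inv_fourier (dist_mult m (dist_fourier u)));
    \<And>x. norm (g x) \<le> B + G x; 0 \<le> B; integrable lborel G; \<And>x. 0 \<le> G x\<rbrakk> \<Longrightarrow>
    AE x in lborel. norm (g x) \<le> K * (B + \<rho> ^ DIM('a) * (LINT x|lborel. G x))"
    using band_limited_sup_bound[OF \<eta>] by metis
  show thesis
  proof (rule that[of "2 * K"])
    show "2 * K > 0" using K by simp
    fix \<rho> s :: real and m :: "'a \<Rightarrow> real" and u
    assume \<rho>: "\<rho> > 0" and s: "s > 0" and As: "\<rho> ^ DIM('a) \<le> A s" and m: "\<And>\<xi>. norm \<xi> > \<rho> \<Longrightarrow> m \<xi> = 0"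
    let ?v = "dist_inv_fourier (dist_mult m (dist_fourier u))"
    have As0: "A s > 0" using As \<rho> by (meson less_le_trans zero_less_power)
    have Ks: "2 * K * s > 0" using K s by simp
    have lux: "sup_norm g \<le> ennreal (2 * K * s) * luxemburg_norm A g" if g: "represents g ?v" for g
      unfolding luxemburg_norm_def
    proof (rule ennreal_le_cmult_Inf[OF Ks], clarify)
      fix \<kappa> :: real
      assume \<kappa>: "\<kappa> > 0" and modular: "(\<integral>\<^sup>+x. ennreal (A (norm (g x) / \<kappa>)) \<partial>lborel) \<le> 1"
      have [measurable]: "g \<in> borel_measurable borel" using g by (simp add: represents_def)
      obtain G where G: "integrable lborel G" "\<And>x. 0 \<le> G x" "\<And>x. norm (g x) \<le> \<kappa> * s + G x"
        "(LINT x|lborel. G x) \<le> \<kappa> * s / A s"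
        using luxemburg_splitting[OF A _ \<kappa> modular s As0] by auto
      have "\<rho> ^ DIM('a) * (LINT x|lborel. G x) \<le> A s * (\<kappa> * s / A s)"
        using As As0 G(2,4) by (intro mult_mono) auto
      then have "K * (\<kappa> * s + \<rho> ^ DIM('a) * (LINT x|lborel. G x)) \<le> K * (\<kappa> * s + \<kappa> * s)"
        using K As0 by (intro mult_left_mono) auto
      also have "\<dots> = 2 * K * s * \<kappa>" by simp
      finally have "K * (\<kappa> * s + \<rho> ^ DIM('a) * (LINT x|lborel. G x)) \<le> 2 * K * s * \<kappa>" .
      moreover have "AE x in lborel. norm (g x) \<le> K * (\<kappa> * s + \<rho> ^ DIM('a) * (LINT x|lborel. G x))"
        by (rule bound[OF \<rho> m g _ _ G(1,2)]) (use G(3) \<kappa> s in auto)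
      ultimately have "AE x in lborel. ennreal (norm (g x)) \<le> ennreal (2 * K * s * \<kappa>)"
        by (auto elim!: eventually_mono intro!: ennreal_leI)
      then have "sup_norm g \<le> ennreal (2 * K * s * \<kappa>)"
        unfolding sup_norm_def by (intro esssup_I) auto
      then show "sup_norm g \<le> ennreal (2 * K * s) * ennreal \<kappa>"
        using Ks \<kappa> by (simp add: ennreal_mult)
    qed
    show "distribution_norm sup_norm ?v \<le> ennreal (2 * K * s) * distribution_norm (luxemburg_norm A) ?v"
      unfolding distribution_norm_def
    proof (rule ennreal_le_cmult_Inf[OF Ks])
      fix x assume "x \<in> luxemburg_norm A ` {g. represents g ?v}"
      then obtain g where g: "represents g ?v" "x = luxemburg_norm A g" by auto
      have "Inf (sup_norm ` {g. represents g ?v}) \<le> sup_norm g" using g(1) by (intro Inf_lower) auto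
      also have "\<dots> \<le> ennreal (2 * K * s) * x" unfolding g(2) by (rule lux[OF g(1)])
      finally show "Inf (sup_norm ` {g. represents g ?v}) \<le> ennreal (2 * K * s) * x" .
    qed
  qed
qed

section \<open>The exponent of a driftless subordinator and its inverse\<close>

lemma one_minus_exp_le_truncation:
  fixes s y :: real
  assumes "s \<ge> 0" "y > 0"
  shows "\<bar>1 - exp (- s * y)\<bar> \<le> max 1 s * min 1 y"
proof -
  have "0 \<le> 1 - exp (- s * y)" using assms by simp
  moreover have "1 - exp (- s * y) \<le> max 1 s * min 1 y"
  proof (cases "y \<le> 1")
    case True
    have "1 - exp (- s * y) \<le> s * y" using exp_ge_add_one_self[of "- s * y"] by simp
    also have "\<dots> \<le> max 1 s * y" using assms by (intro mult_right_mono) auto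
    finally show ?thesis using True by (simp add: min_def)
  next
    case False
    have "1 - exp (- s * y) \<le> 1" by simp
    with False show ?thesis by (simp add: min_def) (smt (verit) exp_gt_zero max.cobounded1)
  qed
  ultimately show ?thesis by simp
qed

context
  fixes \<nu> :: "real measure"
  assumes \<nu>: "subordinator_levy_measure \<nu>"
begin

lemma levy_sets[measurable_cong]: "sets \<nu> = sets borel"
  using \<nu> by (simp add: subordinator_levy_measure_def)

lemma levy_AE_pos: "AE y in \<nu>. y > 0"
  by (rule AE_I[of _ _ "{..0}"]) (use \<nu> in \<open>auto simp: subordinator_levy_measure_def\<close>)

lemma levy_truncation_integrable: "integrable \<nu> (\<lambda>y. min 1 y)"
proof (rule integrableI_nonneg)
  show "AE y in \<nu>. 0 \<le> min 1 y" using levy_AE_pos by eventually_elim simp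
  show "(\<integral>\<^sup>+y. ennreal (min 1 y) \<partial>\<nu>) < \<infinity>" using \<nu> by (simp add: subordinator_levy_measure_def)
qed measurable

lemma levy_exponent_integrable:
  assumes s: "s \<ge> 0"
  shows "integrable \<nu> (\<lambda>y. 1 - exp (- s * y))"
proof (rule Bochner_Integration.integrable_bound[OF integrable_mult_right[OF levy_truncation_integrable, of "max 1 s"]])
  show "AE y in \<nu>. norm (1 - exp (- s * y)) \<le> norm (max 1 s * min 1 y)"
    using levy_AE_pos
  proof eventually_elim
    case (elim y)
    show ?case unfolding real_norm_def
      by (rule order_trans[OF one_minus_exp_le_truncation[OF s elim] abs_ge_self])
  qed
qed measurable

lemma levy_exponent_continuous: "continuous_on {0..} (\<lambda>s. LINT y|\<nu>. 1 - exp (- s * y))"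
proof (rule continuous_on_sequentiallyI)
  fix t :: "nat \<Rightarrow> real" and s
  assume t: "\<forall>n. t n \<in> {0..}" "t \<longlonglongrightarrow> s"
  from t(2) have "Bseq t" by (intro convergent_imp_Bseq convergentI)
  then obtain T where T: "\<And>n. \<bar>t n\<bar> \<le> T" unfolding Bseq_def by auto
  show "(\<lambda>n. LINT y|\<nu>. 1 - exp (- t n * y)) \<longlonglongrightarrow> (LINT y|\<nu>. 1 - exp (- s * y))"
  proof (rule integral_dominated_convergence[where w = "\<lambda>y. max 1 T * min 1 y"])
    show "integrable \<nu> (\<lambda>y. max 1 T * min 1 y)" using levy_truncation_integrable by simp
    show "AE y in \<nu>. (\<lambda>n. 1 - exp (- t n * y)) \<longlonglongrightarrow> 1 - exp (- s * y)"
      by (intro AE_I2 tendsto_intros t)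
    show "AE y in \<nu>. norm (1 - exp (- t n * y)) \<le> max 1 T * min 1 y" for n
      using levy_AE_pos
    proof eventually_elim
      case (elim y)
      have "\<bar>1 - exp (- t n * y)\<bar> \<le> max 1 (t n) * min 1 y"
        using t(1) elim by (intro one_minus_exp_le_truncation) auto
      also have "\<dots> \<le> max 1 T * min 1 y"
        using T[of n] elim by (intro mult_right_mono) auto
      finally show ?case by simp
    qed
  qed measurable
qed

text \<open>
  Equality at \<open>s < t\<close> would force \<open>e\<^sup>-\<^sup>s\<^sup>y = e\<^sup>-\<^sup>t\<^sup>y\<close> for \<open>\<nu>\<close>-almost every \<open>y > 0\<close>, so that \<open>\<nu>\<close>
  would vanish, and with it the exponent at \<open>r\<close>.
\<close>
lemma levy_exponent_strict_mono:
  assumes nonzero: "r \<ge> 0" "(LINT y|\<nu>. 1 - exp (- r * y)) \<noteq> 0" and st: "0 \<le> s" "s < t"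
  shows "(LINT y|\<nu>. 1 - exp (- s * y)) < (LINT y|\<nu>. 1 - exp (- t * y))"
proof (rule ccontr)
  assume neg: "\<not> ?thesis"
  have int: "integrable \<nu> (\<lambda>y. (1 - exp (- t * y)) - (1 - exp (- s * y)))"
    using st by (intro Bochner_Integration.integrable_diff levy_exponent_integrable) auto
  have nonneg: "AE y in \<nu>. 0 \<le> (1 - exp (- t * y)) - (1 - exp (- s * y))"
    using levy_AE_pos by eventually_elim (use st in simp)
  have "(LINT y|\<nu>. (1 - exp (- t * y)) - (1 - exp (- s * y)))
      = (LINT y|\<nu>. 1 - exp (- t * y)) - (LINT y|\<nu>. 1 - exp (- s * y))"
    using st by (intro Bochner_Integration.integral_diff levy_exponent_integrable) auto
  with neg integral_nonneg_AE[OF nonneg]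
  have "(LINT y|\<nu>. (1 - exp (- t * y)) - (1 - exp (- s * y))) = 0" by linarith
  then have "AE y in \<nu>. (1 - exp (- t * y)) - (1 - exp (- s * y)) = 0"
    using integral_nonneg_eq_0_iff_AE[OF int nonneg] by simp
  with levy_AE_pos have "AE y in \<nu>. 1 - exp (- r * y) = 0"
    by eventually_elim (use st in simp)
  then have "(LINT y|\<nu>. 1 - exp (- r * y)) = (LINT y|\<nu>. 0)"
    by (intro integral_cong_AE) measurable
  with nonzero show False by simp
qed

end

lemma laplace_exponent_driftless:
  assumes "driftless_subordinator M S \<nu>" "s \<ge> 0"
  shows "laplace_exponent M S s = (LINT y|\<nu>. 1 - exp (- s * y))"
  using assms by (simp add: driftless_subordinator_def laplace_exponent_def)

text \<open>
  Together these facts make \<open>\<psi>\<close> a bijection of the closed half line, so that the totalised inverse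
  \<open>half_line_inverse \<psi>\<close> is an inverse at every level that occurs below.
\<close>
lemma
  assumes S: "driftless_subordinator M S \<nu>"
    and \<psi>: "\<psi> = (\<lambda>r. laplace_exponent M S (r\<^sup>2))" and top: "filterlim \<psi> at_top at_top"
  shows psi_zero: "\<psi> 0 = 0"
    and psi_strict_mono: "strict_mono_on {0..} \<psi>"
    and psi_surj: "y \<ge> 0 \<Longrightarrow> \<exists>r\<ge>0. \<psi> r = y"
proof -
  have \<nu>: "subordinator_levy_measure \<nu>" using S by (simp add: driftless_subordinator_def)
  define \<Phi> where "\<Phi> s = (LINT y|\<nu>. 1 - exp (- s * y))" for s
  have \<psi>_eq: "\<psi> r = \<Phi> (r\<^sup>2)" for r
    by (simp add: \<psi> \<Phi>_def laplace_exponent_driftless[OF S])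
  show zero: "\<psi> 0 = 0" by (simp add: \<psi>_eq \<Phi>_def)
  have large: "\<exists>r\<ge>0. \<psi> r \<ge> y" for y
    using eventually_conj[OF filterlim_at_top[THEN iffD1, OF top, rule_format, of y] eventually_ge_at_top[of 0]]
    by (auto dest!: eventually_happens)
  obtain r where "\<psi> r \<ge> 1" using large by blast
  then have r: "r\<^sup>2 \<ge> 0" "\<Phi> (r\<^sup>2) \<noteq> 0" by (auto simp: \<psi>_eq)
  show "strict_mono_on {0..} \<psi>"
  proof (rule strict_mono_onI)
    fix s t :: real assume "s \<in> {0..}" "t \<in> {0..}" "s < t"
    then have "s\<^sup>2 < t\<^sup>2" by (simp add: power_strict_mono)
    then show "\<psi> s < \<psi> t"
      unfolding \<psi>_eq \<Phi>_def by (intro levy_exponent_strict_mono[OF \<nu> r[unfolded \<Phi>_def]]) auto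
  qed
  show "\<exists>r\<ge>0. \<psi> r = y" if y: "y \<ge> 0"
  proof -
    obtain b where b: "b \<ge> 0" "\<psi> b \<ge> y" using large by blast
    have "continuous_on {0..b} (\<lambda>r. \<Phi> (r\<^sup>2))"
      unfolding \<Phi>_def
      by (rule continuous_on_compose2[OF levy_exponent_continuous[OF \<nu>]]) (auto intro!: continuous_intros)
    then have "continuous_on {0..b} \<psi>" unfolding \<psi>_eq[abs_def] .
    from IVT'[OF _ b(2) b(1) this] y zero show ?thesis by auto
  qed
qed

lemma
  assumes mono: "strict_mono_on {0..} \<psi>" and surj: "\<And>y. y \<ge> 0 \<Longrightarrow> \<exists>r\<ge>0. \<psi> r = y" and y: "y \<ge> 0"
  shows half_line_inverse_nonneg: "half_line_inverse \<psi> y \<ge> 0"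
    and half_line_inverse_right: "\<psi> (half_line_inverse \<psi> y) = y"
proof -
  have inj: "inj_on \<psi> {0..}" using mono by (rule strict_mono_on_imp_inj_on)
  have "y \<in> \<psi> ` {0..}" using surj[OF y] by auto
  then show "half_line_inverse \<psi> y \<ge> 0" "\<psi> (half_line_inverse \<psi> y) = y"
    using the_inv_into_into[OF inj _ order_refl, of y] f_the_inv_into_f[OF inj, of y]
    by (auto simp: half_line_inverse_def)
qed

lemma half_line_inverse_mono:
  assumes mono: "strict_mono_on {0..} \<psi>" and surj: "\<And>y. y \<ge> 0 \<Longrightarrow> \<exists>r\<ge>0. \<psi> r = y"
    and "0 \<le> y" "y \<le> z"
  shows "half_line_inverse \<psi> y \<le> half_line_inverse \<psi> z"
proof (rule ccontr)
  assume "\<not> ?thesis"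
  then have "\<psi> (half_line_inverse \<psi> z) < \<psi> (half_line_inverse \<psi> y)"
    using assms by (intro strict_mono_onD[OF mono]) (auto intro!: half_line_inverse_nonneg[OF mono surj])
  with assms show False by (simp add: half_line_inverse_right[OF mono surj])
qed

text \<open>
  The block with index \<open>j \<ge> 0\<close> is a difference of cutoffs at the levels \<open>2\<^sup>j\<close> and \<open>2\<^sup>j\<^sup>+\<^sup>1\<close>, and the
  block with index \<open>-1\<close> is the cutoff at level \<open>2\<^sup>0\<close>; in all cases \<open>j + 1\<close> indexes the outer radius.
\<close>
lemma psi_multiplier_support:
  assumes \<eta>: "cutoff \<eta>" and j: "j \<ge> -1"
    and pos: "\<And>i. half_line_inverse \<psi> (2 ^ i) > 0"
    and mono: "\<And>i. half_line_inverse \<psi> (2 ^ i) \<le> half_line_inverse \<psi> (2 ^ Suc i)"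
    and \<xi>: "norm \<xi> > half_line_inverse \<psi> (2 ^ nat (j + 1))"
  shows "psi_multiplier \<eta> \<psi> j \<xi> = 0"
proof -
  have vanish: "psi_cutoff \<eta> \<psi> i \<xi> = 0" if "half_line_inverse \<psi> (2 ^ i) \<le> half_line_inverse \<psi> (2 ^ nat (j + 1))" for i
  proof -
    have "norm (\<xi> /\<^sub>R half_line_inverse \<psi> (2 ^ i)) \<ge> 1"
      using pos[of i] that \<xi> by (simp add: divide_simps)
    then show ?thesis using \<eta> by (simp add: psi_cutoff_def cutoff_def)
  qed
  show ?thesis
  proof (cases "j \<ge> 0")
    case True
    then have "nat (j + 1) = Suc (nat j)" by simp
    with True mono[of "nat j"] show ?thesis by (simp add: psi_multiplier_def vanish)
  next
    case False
    with j have "j = -1" by simp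
    then show ?thesis by (simp add: psi_multiplier_def vanish)
  qed
qed

section \<open>The embedding\<close>

theorem theorem3p13:
  fixes M :: "'w measure" and S :: "real \<Rightarrow> 'w \<Rightarrow> real" and \<nu> :: "real measure"
    and \<phi> \<psi> A :: "real \<Rightarrow> real" and \<eta> :: "'a::euclidean_space \<Rightarrow> real"
    and \<alpha> \<epsilon> c :: real
  assumes "driftless_subordinator M S \<nu>"
    and "\<phi> = laplace_exponent M S"
    and "\<psi> = (\<lambda>r. \<phi> (r\<^sup>2))"
    and "filterlim \<psi> at_top at_top"
    and "cutoff \<eta>"
    and "0 \<le> \<alpha>" and "\<alpha> < 1"
    and "regularly_varying \<phi> (\<alpha> / 2)"
    and "N_function A"
    and "\<epsilon> > 0" and "c > 0"
    and "\<forall>t\<ge>0. A t \<ge> half_line_inverse \<psi> (c * t powr (1 + \<epsilon>)) ^ DIM('a)"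
  shows "\<exists>C>0. \<forall>u \<in> besov_orlicz_space \<eta> \<psi> A 1.
           holder_zygmund_norm \<eta> \<psi> (\<epsilon> / (1 + \<epsilon>)) u \<le> ennreal C * besov_orlicz_norm \<eta> \<psi> A 1 u"
proof -
  have \<psi>: "\<psi> = (\<lambda>r. laplace_exponent M S (r\<^sup>2))" using assms(2,3) by simp
  note mono = psi_strict_mono[OF assms(1) \<psi> assms(4)]
  note surj = psi_surj[OF assms(1) \<psi> assms(4)]
  define R where "R i = half_line_inverse \<psi> (2 ^ i)" for i :: nat
  have \<psi>_R: "\<psi> (R i) = 2 ^ i" and R_nonneg: "R i \<ge> 0" for i
    by (simp_all add: R_def half_line_inverse_right[OF mono surj] half_line_inverse_nonneg[OF mono surj])
  have R_pos: "R i > 0" for i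
    using R_nonneg[of i] \<psi>_R[of i] psi_zero[OF assms(1) \<psi> assms(4)] by (cases "R i = 0") auto
  obtain K where K: "K > 0" and block: "\<And>\<rho> s (m :: 'a \<Rightarrow> real) u. \<lbrakk>\<rho> > 0; s > 0; \<rho> ^ DIM('a) \<le> A s; \<And>\<xi>. norm \<xi> > \<rho> \<Longrightarrow> m \<xi> = 0\<rbrakk> \<Longrightarrow>
     distribution_norm sup_norm (dist_inv_fourier (dist_mult m (dist_fourier u)))
     \<le> ennreal (K * s) * distribution_norm (luxemburg_norm A) (dist_inv_fourier (dist_mult m (dist_fourier u)))"
    using band_limited_sup_luxemburg[OF assms(5) assms(9)] by metis
  define a where "a = 1 / (1 + \<epsilon>)"
  have a: "a * (1 + \<epsilon>) = 1" "\<epsilon> / (1 + \<epsilon>) + a = 1" using assms(10) by (auto simp: a_def field_simps)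
  define C where "C = K * (2 / c) powr a"
  have "C > 0" using K assms(11) by (simp add: C_def)
  have term_le: "ennreal (2 powr (of_int j * (\<epsilon> / (1 + \<epsilon>)))) * distribution_norm sup_norm (psi_block \<eta> \<psi> j u)
      \<le> ennreal C * (ennreal (2 powr (of_int j * 1)) * distribution_norm (luxemburg_norm A) (psi_block \<eta> \<psi> j u))"
    if j: "j \<in> {-1..}" for j u
  proof -
    define i where "i = nat (j + 1)"
    \<comment> \<open>The level at which the growth assumption on \<open>A\<close> reads \<open>A s \<ge> R i ^ d\<close>.\<close>
    define s where "s = (2 ^ i / c) powr a"
    have pow: "(2::real) ^ i = 2 * 2 powr of_int j"
    proof -
      have "(2::real) ^ i = 2 powr real i" by (simp add: powr_realpow)
      also have "real i = 1 + of_int j" using j by (simp add: i_def)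
      finally show ?thesis by (simp add: powr_add)
    qed
    have s: "s > 0" using assms(11) by (simp add: s_def)
    have "s powr (1 + \<epsilon>) = 2 ^ i / c"
      using assms(11) a(1) by (simp add: s_def powr_powr)
    then have "c * s powr (1 + \<epsilon>) = 2 ^ i" using assms(11) by simp
    then have "R i ^ DIM('a) \<le> A s" using assms(12)[rule_format, of s] s by (simp add: R_def)
    then have le: "distribution_norm sup_norm (psi_block \<eta> \<psi> j u)
        \<le> ennreal (K * s) * distribution_norm (luxemburg_norm A) (psi_block \<eta> \<psi> j u)"
      unfolding psi_block_def
    proof (intro block[OF R_pos s])
      fix \<xi> :: 'a assume "norm \<xi> > R i"
      then show "psi_multiplier \<eta> \<psi> j \<xi> = 0"
        using assms(5) j R_pos unfolding R_def i_def
        by (intro psi_multiplier_support) (auto intro!: half_line_inverse_mono[OF mono surj])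
    qed
    have s_eq: "s = (2 / c) powr a * 2 powr (of_int j * a)"
    proof -
      have "2 ^ i / c = (2 / c) * 2 powr of_int j" using pow by simp
      then show ?thesis using assms(11) by (simp only: s_def powr_mult powr_powr)
    qed
    have "2 powr (of_int j * (\<epsilon> / (1 + \<epsilon>))) * (K * s) = C * (2 powr (of_int j * (\<epsilon> / (1 + \<epsilon>))) * 2 powr (of_int j * a))"
      by (simp add: s_eq C_def)
    also have "\<dots> = C * 2 powr (of_int j * (\<epsilon> / (1 + \<epsilon>) + a))"
      by (simp add: powr_add[symmetric] distrib_left)
    finally have const: "2 powr (of_int j * (\<epsilon> / (1 + \<epsilon>))) * (K * s) = C * 2 powr (of_int j * 1)"
      unfolding a(2) .
    have "ennreal (2 powr (of_int j * (\<epsilon> / (1 + \<epsilon>)))) * distribution_norm sup_norm (psi_block \<eta> \<psi> j u)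
        \<le> ennreal (2 powr (of_int j * (\<epsilon> / (1 + \<epsilon>)))) * (ennreal (K * s) * distribution_norm (luxemburg_norm A) (psi_block \<eta> \<psi> j u))"
      by (intro mult_left_mono le) simp
    also have "\<dots> = ennreal (2 powr (of_int j * (\<epsilon> / (1 + \<epsilon>))) * (K * s)) * distribution_norm (luxemburg_norm A) (psi_block \<eta> \<psi> j u)"
      using K s by (subst ennreal_mult) (auto simp: mult.assoc)
    also have "\<dots> = ennreal C * (ennreal (2 powr (of_int j * 1)) * distribution_norm (luxemburg_norm A) (psi_block \<eta> \<psi> j u))"
      unfolding const using \<open>C > 0\<close> by (subst ennreal_mult) (auto simp: mult.assoc)
    finally show ?thesis .
  qed
  have "holder_zygmund_norm \<eta> \<psi> (\<epsilon> / (1 + \<epsilon>)) u \<le> ennreal C * besov_orlicz_norm \<eta> \<psi> A 1 u" for u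
    unfolding holder_zygmund_norm_def besov_orlicz_norm_def psi_norm_def
  proof (rule SUP_least)
    fix j :: int assume j: "j \<in> {-1..}"
    show "ennreal (2 powr (of_int j * (\<epsilon> / (1 + \<epsilon>)))) * distribution_norm sup_norm (psi_block \<eta> \<psi> j u)
      \<le> ennreal C * (SUP j\<in>{-1..}. ennreal (2 powr (of_int j * 1)) * distribution_norm (luxemburg_norm A) (psi_block \<eta> \<psi> j u))"
      by (rule order_trans[OF term_le[OF j]]) (intro mult_left_mono SUP_upper j, simp)
  qed
  with \<open>C > 0\<close> show ?thesis by blast
qed

end
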